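(* Let $a_2>a_1>0$, $c>0$, $A=a_2/a_1>1$, $K_2\in(0,1)$, $n\in\mathbb{N}_0$, let $m^*(n)=n(A-1)+\frac{A-3-K_2}{2+K_2}$ and $$m^\dagger(n)=m^*(n)+\min\left\{\frac{1+K_2}{2+K_2},\ 1-\frac{A-1}{(2+K_2)(3+K_2)}\right\}.$$ Let $m$ be an integer with $m\in(n(A-1),m^\dagger(n))$ and let $M_{nm}^+$ be the larger root of the quadratic polynomial $G_{nm}$ defined in the context. Then there exists $\delta>0$ such that for every $K_1\in(M_{nm}^+-\delta,M_{nm}^+)$ the equation $\epsilon\dot u(t)=-u(t)-K_1u(t-a_1-cu(t))-K_2u(t-a_2-cu(t))$ has a) a unimodal $(n,m)$-solution at $K_1$, and b) a type I bimodal $(n,m)$-solution at $K_1$ (both defined in the context), and these solutions coincide at $K_1=M_{nm}^+$, i.e. the limiting profiles and the limiting periods of the two solutions as $K_1\to M_{nm}^+$ are identical.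
   Context: $\mathbb{N}_0=\{0,1,2,\dots\}$. $$G_{nm}(K_1)=\bigl[m-n(A-1)\bigr]\bigl((K_1+K_2)^2-1\bigr)-K_1\bigl[(A-1)(1+K_2)-K_2\bigr]+K_2(1+K_2)+(A-1).$$ Unimodal $(n,m)$-solution at $K_1$: this exists if $K_1>1$ and, with $$T=\frac{a_1(1+K_1+K_2)+(a_2-a_1)K_2}{1+(m+1)K_2+n(1+K_1+K_2)},\qquad \theta=\frac{a_2-a_1}{T}-m,$$ one has $\theta\in\left(\frac{K_2}{K_1+K_2-1},1\right)$, and the equation has a periodic singular solution (defined below) of period $T$ with sawtooth profile: for each $i\in\mathbb{Z}$, $t(\mu)=(\mu-i)T$, $u(\mu)=\frac1c(-a_1+(n+\mu-2i)T)$ for $\mu\in[2i,2i+1]$, and $t(\mu)=(i+1)T$, $u(\mu)=\frac1c(-a_1+(n+1-(\mu-2i-1))T)$ for $\mu\in(2i+1,2i+2)$. Type I bimodal $(n,m)$-solution at $K_1$: this exists if $K_1>1$ and, with (denominators nonzero) $$T=\frac{a_1(1+K_1+K_2)+(a_2-a_1)(1-K_1)}{1-m(K_1-1)+n(1+K_1+K_2)},\quad T_2=\frac{a_1G_{nm}(K_1)}{1-m(K_1-1)+n(1+K_1+K_2)},\quad T_1=T-T_2,\quad \theta=\frac{a_2-a_1-mT-T_2}{T_1},$$ one has $T_2>0$, $\theta\in(0,1-1/K_1)$ and $\frac{K_2}{K_1-1}T_2<\theta T_1<T_1-\frac{1}{K_2}T_2$, and the equation has a periodic singular solution of period $T>0$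 with profile given for each $i\in\mathbb{Z}$ by: $\mu\in[4i,4i+1]$: $t=(\mu-4i)T_1+iT$, $u=\frac1c(-a_1+nT+(\mu-4i)T_1)$; $\mu\in[4i+1,4i+2]$: $t=T_1+iT$, $u=\frac1c(-a_1+nT+T_1-(\mu-4i-1)(T_2+\theta T_1))$; $\mu\in[4i+2,4i+3]$: $t=(\mu-4i-2)T_2+T_1+iT$, $u=\frac1c(-a_1+nT+(1-\theta)T_1+(\mu-4i-3)T_2)$; $\mu\in[4i+3,4i+4]$: $t=(i+1)T$, $u=\frac1c(-a_1+nT+(4i+4-\mu)(1-\theta)T_1)$. Here $T$ and $\theta$ for the two types of solution are defined by different formulas. "Profile" in the coincidence statement means the curve traced out in the $(t,u)$-plane. Admissible singular solution profile: a continuous injective parametric curve $\Gamma:I\to\mathbb{R}^2$, $\Gamma(\mu)=(t(\mu),u(\mu))$, on a nonempty interval $I\subseteq\mathbb{R}$, with $t$ monotonically increasing (not necessarily strictly). The interval $I$ is partitioned as $I=I^+\cup I^-\cup I^*$, where $I^*$ is a disjoint union of open intervals on each of which $t$ is strictly increasing, and $I^{\pm}$ are disjoint unions of closed intervals on each of which $t$ is constant, with $u$ strictly decreasing on each interval of $I^-$ and strictly increasing on each interval of $I^+$. Singular solution of $\epsilon\dot u(t)=-u(t)-K_1u(t-a_1-cu(t))-K_2u(t-a_2-cu(t))$ (an $\epsilon=0$ notion): let $\Gamma$ be an admissible singular solution profile on $I$, $J\subseteq\mathbb{R}$ a nonempty interval, and $\mu_0,\mu_1,\mu_2:J\to I$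 continuous with $\mu_0$ monotonically increasing. Set $J^*=\mathrm{cl}\{\eta:\mu_0(\eta)\in I^*\}$, $J^\pm=\mathrm{int}\{\eta:\mu_0(\eta)\in I^\pm\}$ and $F(\eta)=-u(\mu_0(\eta))-K_1u(\mu_1(\eta))-K_2u(\mu_2(\eta))$. Then $\{\Gamma,\mu_0,\mu_1,\mu_2\}$ is a singular solution on $t(\mu_0(J))$ if $t(\mu_i(\eta))=t(\mu_0(\eta))-a_i-cu(\mu_0(\eta))$ for all $\eta\in J$, $i=1,2$, and $F=0$ on $J^*$, $F<0$ on $J^-$, $F>0$ on $J^+$. It is periodic if $J=\mathbb{R}$ and there exist $T>0$, $\eta_T>0$ with $t(\mu_i(\eta+\eta_T))=t(\mu_i(\eta))+T$ and $u(\mu_i(\eta+\eta_T))=u(\mu_i(\eta))$ for all $i=0,1,2$ and $\eta\in\mathbb{R}$; the period is the smallest such $T$. *)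

theory Defs
  imports "HOL-Analysis.Analysis"
begin

section \<open>Singular solutions\<close>

text \<open>
  The intervals making up \<open>Istar\<close>, \<open>Iplus\<close> and \<open>Iminus\<close> are
  nondegenerate.  Admitting one-point closed intervals would make the monotonicity conditions
  vacuous on them and the partition of \<open>I\<close> ambiguous.
\<close>

definition admissible_profile ::
    "(real \<Rightarrow> real \<times> real) \<Rightarrow> real set \<Rightarrow> real set \<Rightarrow> real set \<Rightarrow> real set \<Rightarrow> bool" where
  "admissible_profile \<Gamma> I Iplus Iminus Istar \<longleftrightarrow>
     is_interval I \<and> I \<noteq> {} \<and> continuous_on I \<Gamma> \<and> inj_on \<Gamma> I \<and>
     mono_on I (\<lambda>\<mu>. fst (\<Gamma> \<mu>)) \<and>
     I = Iplus \<union> Iminus \<union> Istar \<and> Iplus \<inter> Iminus = {} \<and> Iplus \<inter> Istar = {} \<and> Iminus \<inter> Istar = {} \<and>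
     (\<exists>C. partition_on Istar C \<and>
        (\<forall>X\<in>C. is_interval X \<and> open X \<and> strict_mono_on X (\<lambda>\<mu>. fst (\<Gamma> \<mu>)))) \<and>
     (\<exists>C. partition_on Iminus C \<and>
        (\<forall>X\<in>C. is_interval X \<and> closed X \<and> interior X \<noteq> {} \<and>
           (\<lambda>\<mu>. fst (\<Gamma> \<mu>)) constant_on X \<and> strict_antimono_on X (\<lambda>\<mu>. snd (\<Gamma> \<mu>)))) \<and>
     (\<exists>C. partition_on Iplus C \<and>
        (\<forall>X\<in>C. is_interval X \<and> closed X \<and> interior X \<noteq> {} \<and>
           (\<lambda>\<mu>. fst (\<Gamma> \<mu>)) constant_on X \<and> strict_mono_on X (\<lambda>\<mu>. snd (\<Gamma> \<mu>))))"

text \<open>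
  Singular solutions of
  \<open>\<epsilon> u'(t) = - u(t) - K1 u(t - a1 - c u(t)) - K2 u(t - a2 - c u(t))\<close>.
  The closure is taken relative to \<open>J\<close>, since \<open>F\<close> is only meaningful there.
\<close>

definition singular_solution ::
    "real \<Rightarrow> real \<Rightarrow> real \<Rightarrow> real \<Rightarrow> real \<Rightarrow> (real \<Rightarrow> real \<times> real) \<Rightarrow> real set \<Rightarrow>
     real set \<Rightarrow> (real \<Rightarrow> real) \<Rightarrow> (real \<Rightarrow> real) \<Rightarrow> (real \<Rightarrow> real) \<Rightarrow> bool" where
  "singular_solution a1 a2 c K1 K2 \<Gamma> I J \<mu>0 \<mu>1 \<mu>2 \<longleftrightarrow>
     (let t = (\<lambda>\<mu>. fst (\<Gamma> \<mu>)); u = (\<lambda>\<mu>. snd (\<Gamma> \<mu>));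
          F = (\<lambda>\<eta>. - u (\<mu>0 \<eta>) - K1 * u (\<mu>1 \<eta>) - K2 * u (\<mu>2 \<eta>))
      in \<exists>Iplus Iminus Istar.
           admissible_profile \<Gamma> I Iplus Iminus Istar \<and>
           is_interval J \<and> J \<noteq> {} \<and>
           continuous_on J \<mu>0 \<and> continuous_on J \<mu>1 \<and> continuous_on J \<mu>2 \<and>
           \<mu>0 ` J \<subseteq> I \<and> \<mu>1 ` J \<subseteq> I \<and> \<mu>2 ` J \<subseteq> I \<and>
           mono_on J \<mu>0 \<and>
           (\<forall>\<eta>\<in>J. t (\<mu>1 \<eta>) = t (\<mu>0 \<eta>) - a1 - c * u (\<mu>0 \<eta>)) \<and>
           (\<forall>\<eta>\<in>J. t (\<mu>2 \<eta>) = t (\<mu>0 \<eta>) - a2 - c * u (\<mu>0 \<eta>)) \<and>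
           (\<forall>\<eta>\<in>J \<inter> closure {\<eta>\<in>J. \<mu>0 \<eta> \<in> Istar}. F \<eta> = 0) \<and>
           (\<forall>\<eta>\<in>interior {\<eta>\<in>J. \<mu>0 \<eta> \<in> Iminus}. F \<eta> < 0) \<and>
           (\<forall>\<eta>\<in>interior {\<eta>\<in>J. \<mu>0 \<eta> \<in> Iplus}. F \<eta> > 0))"

definition translation_periods ::
    "(real \<Rightarrow> real \<times> real) \<Rightarrow> (real \<Rightarrow> real) \<Rightarrow> (real \<Rightarrow> real) \<Rightarrow> (real \<Rightarrow> real) \<Rightarrow> real set" where
  "translation_periods \<Gamma> \<mu>0 \<mu>1 \<mu>2 =
     {T. T > 0 \<and> (\<exists>\<eta>T>0. \<forall>\<eta>. \<forall>\<mu>\<in>{\<mu>0, \<mu>1, \<mu>2}.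
            fst (\<Gamma> (\<mu> (\<eta> + \<eta>T))) = fst (\<Gamma> (\<mu> \<eta>)) + T \<and>
            snd (\<Gamma> (\<mu> (\<eta> + \<eta>T))) = snd (\<Gamma> (\<mu> \<eta>)))}"

definition periodic_singular_solution ::
    "real \<Rightarrow> real \<Rightarrow> real \<Rightarrow> real \<Rightarrow> real \<Rightarrow> (real \<Rightarrow> real \<times> real) \<Rightarrow> real set \<Rightarrow>
     (real \<Rightarrow> real) \<Rightarrow> (real \<Rightarrow> real) \<Rightarrow> (real \<Rightarrow> real) \<Rightarrow> real \<Rightarrow> bool" where
  "periodic_singular_solution a1 a2 c K1 K2 \<Gamma> I \<mu>0 \<mu>1 \<mu>2 T \<longleftrightarrow>
     singular_solution a1 a2 c K1 K2 \<Gamma> I UNIV \<mu>0 \<mu>1 \<mu>2 \<and>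
     T \<in> translation_periods \<Gamma> \<mu>0 \<mu>1 \<mu>2 \<and>
     (\<forall>T'\<in>translation_periods \<Gamma> \<mu>0 \<mu>1 \<mu>2. T \<le> T')"

section \<open>Unimodal solutions\<close>

definition uni_T :: "real \<Rightarrow> real \<Rightarrow> real \<Rightarrow> nat \<Rightarrow> int \<Rightarrow> real \<Rightarrow> real" where
  "uni_T a1 a2 K2 n m K1 =
     (a1 * (1 + K1 + K2) + (a2 - a1) * K2) /
     (1 + (of_int m + 1) * K2 + of_nat n * (1 + K1 + K2))"

definition uni_theta :: "real \<Rightarrow> real \<Rightarrow> real \<Rightarrow> nat \<Rightarrow> int \<Rightarrow> real \<Rightarrow> real" where
  "uni_theta a1 a2 K2 n m K1 = (a2 - a1) / uni_T a1 a2 K2 n m K1 - of_int m"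

definition uni_curve :: "real \<Rightarrow> real \<Rightarrow> nat \<Rightarrow> real \<Rightarrow> real \<Rightarrow> real \<times> real" where
  "uni_curve a1 c n T \<mu> =
     (let i = real_of_int \<lfloor>\<mu> / 2\<rfloor>
      in if \<mu> \<le> 2 * i + 1
         then ((\<mu> - i) * T, 1 / c * (- a1 + (of_nat n + \<mu> - 2 * i) * T))
         else ((i + 1) * T, 1 / c * (- a1 + (of_nat n + 1 - (\<mu> - 2 * i - 1)) * T)))"

lemma uni_curve_1:
  fixes i :: int
  assumes "\<mu> \<in> {2 * of_int i .. 2 * of_int i + 1}"
  shows "uni_curve a1 c n T \<mu> =
           ((\<mu> - of_int i) * T, 1 / c * (- a1 + (of_nat n + \<mu> - 2 * of_int i) * T))"
proof -
  have "\<lfloor>\<mu> / 2\<rfloor> = i" using assms by (intro floor_unique) auto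
  with assms show ?thesis by (simp add: uni_curve_def Let_def)
qed

lemma uni_curve_2:
  fixes i :: int
  assumes "\<mu> \<in> {2 * of_int i + 1 <..< 2 * of_int i + 2}"
  shows "uni_curve a1 c n T \<mu> =
           ((of_int i + 1) * T, 1 / c * (- a1 + (of_nat n + 1 - (\<mu> - 2 * of_int i - 1)) * T))"
proof -
  have "\<lfloor>\<mu> / 2\<rfloor> = i" using assms by (intro floor_unique) auto
  with assms show ?thesis by (simp add: uni_curve_def Let_def)
qed

definition unimodal_solution ::
    "real \<Rightarrow> real \<Rightarrow> real \<Rightarrow> real \<Rightarrow> nat \<Rightarrow> int \<Rightarrow> real \<Rightarrow> bool" where
  "unimodal_solution a1 a2 c K2 n m K1 \<longleftrightarrow>
     K1 > 1 \<and>
     uni_theta a1 a2 K2 n m K1 \<in> {K2 / (K1 + K2 - 1) <..< 1} \<and>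
     (\<exists>\<mu>0 \<mu>1 \<mu>2. periodic_singular_solution a1 a2 c K1 K2
        (uni_curve a1 c n (uni_T a1 a2 K2 n m K1)) UNIV \<mu>0 \<mu>1 \<mu>2 (uni_T a1 a2 K2 n m K1))"

section \<open>The polynomial \<open>G\<close> and the thresholds in \<open>m\<close>\<close>

definition G_poly :: "real \<Rightarrow> real \<Rightarrow> nat \<Rightarrow> int \<Rightarrow> real \<Rightarrow> real" where
  "G_poly A K2 n m K1 =
     (of_int m - of_nat n * (A - 1)) * ((K1 + K2)^2 - 1)
     - K1 * ((A - 1) * (1 + K2) - K2) + K2 * (1 + K2) + (A - 1)"

definition M_plus :: "real \<Rightarrow> real \<Rightarrow> nat \<Rightarrow> int \<Rightarrow> real" where
  "M_plus A K2 n m = Max {K1. G_poly A K2 n m K1 = 0}"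

definition m_star :: "real \<Rightarrow> real \<Rightarrow> nat \<Rightarrow> real" where
  "m_star A K2 n = of_nat n * (A - 1) + (A - 3 - K2) / (2 + K2)"

definition m_dagger :: "real \<Rightarrow> real \<Rightarrow> nat \<Rightarrow> real" where
  "m_dagger A K2 n = m_star A K2 n +
     min ((1 + K2) / (2 + K2)) (1 - (A - 1) / ((2 + K2) * (3 + K2)))"

section \<open>Type I bimodal solutions\<close>

definition bi_denom :: "real \<Rightarrow> nat \<Rightarrow> int \<Rightarrow> real \<Rightarrow> real" where
  "bi_denom K2 n m K1 = 1 - of_int m * (K1 - 1) + of_nat n * (1 + K1 + K2)"

definition bi_T :: "real \<Rightarrow> real \<Rightarrow> real \<Rightarrow> nat \<Rightarrow> int \<Rightarrow> real \<Rightarrow> real" where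
  "bi_T a1 a2 K2 n m K1 =
     (a1 * (1 + K1 + K2) + (a2 - a1) * (1 - K1)) / bi_denom K2 n m K1"

definition bi_T2 :: "real \<Rightarrow> real \<Rightarrow> real \<Rightarrow> nat \<Rightarrow> int \<Rightarrow> real \<Rightarrow> real" where
  "bi_T2 a1 a2 K2 n m K1 = a1 * G_poly (a2 / a1) K2 n m K1 / bi_denom K2 n m K1"

definition bi_T1 :: "real \<Rightarrow> real \<Rightarrow> real \<Rightarrow> nat \<Rightarrow> int \<Rightarrow> real \<Rightarrow> real" where
  "bi_T1 a1 a2 K2 n m K1 = bi_T a1 a2 K2 n m K1 - bi_T2 a1 a2 K2 n m K1"

definition bi_theta :: "real \<Rightarrow> real \<Rightarrow> real \<Rightarrow> nat \<Rightarrow> int \<Rightarrow> real \<Rightarrow> real" where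
  "bi_theta a1 a2 K2 n m K1 =
     (a2 - a1 - of_int m * bi_T a1 a2 K2 n m K1 - bi_T2 a1 a2 K2 n m K1) / bi_T1 a1 a2 K2 n m K1"

definition bi_curve ::
    "real \<Rightarrow> real \<Rightarrow> nat \<Rightarrow> real \<Rightarrow> real \<Rightarrow> real \<Rightarrow> real \<Rightarrow> real \<times> real" where
  "bi_curve a1 c n T1 T2 \<theta> \<mu> =
     (let i = real_of_int \<lfloor>\<mu> / 4\<rfloor>; T = T1 + T2
      in if \<mu> \<le> 4 * i + 1
         then ((\<mu> - 4 * i) * T1 + i * T,
               1 / c * (- a1 + of_nat n * T + (\<mu> - 4 * i) * T1))
         else if \<mu> \<le> 4 * i + 2
         then (T1 + i * T,
               1 / c * (- a1 + of_nat n * T + T1 - (\<mu> - 4 * i - 1) * (T2 + \<theta> * T1)))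
         else if \<mu> \<le> 4 * i + 3
         then ((\<mu> - 4 * i - 2) * T2 + T1 + i * T,
               1 / c * (- a1 + of_nat n * T + (1 - \<theta>) * T1 + (\<mu> - 4 * i - 3) * T2))
         else ((i + 1) * T,
               1 / c * (- a1 + of_nat n * T + (4 * i + 4 - \<mu>) * (1 - \<theta>) * T1)))"

lemma bi_curve_1:
  fixes i :: int
  assumes "\<mu> \<in> {4 * of_int i .. 4 * of_int i + 1}" and "T = T1 + T2"
  shows "bi_curve a1 c n T1 T2 \<theta> \<mu> =
           ((\<mu> - 4 * of_int i) * T1 + of_int i * T,
            1 / c * (- a1 + of_nat n * T + (\<mu> - 4 * of_int i) * T1))"
proof -
  have "\<lfloor>\<mu> / 4\<rfloor> = i" using assms by (intro floor_unique) auto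
  with assms show ?thesis by (simp add: bi_curve_def Let_def)
qed

lemma bi_curve_2:
  fixes i :: int
  assumes "\<mu> \<in> {4 * of_int i + 1 .. 4 * of_int i + 2}" and "T = T1 + T2"
  shows "bi_curve a1 c n T1 T2 \<theta> \<mu> =
           (T1 + of_int i * T,
            1 / c * (- a1 + of_nat n * T + T1 - (\<mu> - 4 * of_int i - 1) * (T2 + \<theta> * T1)))"
proof -
  have "\<lfloor>\<mu> / 4\<rfloor> = i" using assms by (intro floor_unique) auto
  moreover have "\<mu> \<le> 4 * of_int i + 1 \<longleftrightarrow> \<mu> = 4 * of_int i + 1" using assms by auto
  ultimately show ?thesis using assms by (simp add: bi_curve_def Let_def)
qed

lemma bi_curve_3:
  fixes i :: int
  assumes "\<mu> \<in> {4 * of_int i + 2 .. 4 * of_int i + 3}" and "T = T1 + T2"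
  shows "bi_curve a1 c n T1 T2 \<theta> \<mu> =
           ((\<mu> - 4 * of_int i - 2) * T2 + T1 + of_int i * T,
            1 / c * (- a1 + of_nat n * T + (1 - \<theta>) * T1 + (\<mu> - 4 * of_int i - 3) * T2))"
proof -
  have "\<lfloor>\<mu> / 4\<rfloor> = i" using assms by (intro floor_unique) auto
  moreover have "\<not> \<mu> \<le> 4 * of_int i + 1" using assms by auto
  moreover have "\<mu> \<le> 4 * of_int i + 2 \<longleftrightarrow> \<mu> = 4 * of_int i + 2" using assms by auto
  ultimately show ?thesis using assms by (simp add: bi_curve_def Let_def algebra_simps add_divide_distrib diff_divide_distrib)
qed

lemma bi_curve_4:
  fixes i :: int
  assumes "\<mu> \<in> {4 * of_int i + 3 .. 4 * of_int i + 4}" and "T = T1 + T2"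
  shows "bi_curve a1 c n T1 T2 \<theta> \<mu> =
           ((of_int i + 1) * T,
            1 / c * (- a1 + of_nat n * T + (4 * of_int i + 4 - \<mu>) * (1 - \<theta>) * T1))"
proof (cases "\<mu> = 4 * of_int i + 4")
  case True
  then have "\<lfloor>\<mu> / 4\<rfloor> = i + 1" by (intro floor_unique) auto
  with True assms show ?thesis by (simp add: bi_curve_def Let_def)
next
  case False
  with assms have "\<lfloor>\<mu> / 4\<rfloor> = i" by (intro floor_unique) auto
  moreover have "\<not> \<mu> \<le> 4 * of_int i + 1" "\<not> \<mu> \<le> 4 * of_int i + 2" using assms by auto
  moreover have "\<mu> \<le> 4 * of_int i + 3 \<longleftrightarrow> \<mu> = 4 * of_int i + 3" using assms by auto
  ultimately show ?thesis using assms by (simp add: bi_curve_def Let_def algebra_simps add_divide_distrib diff_divide_distrib)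
qed

definition bimodal_I_solution ::
    "real \<Rightarrow> real \<Rightarrow> real \<Rightarrow> real \<Rightarrow> nat \<Rightarrow> int \<Rightarrow> real \<Rightarrow> bool" where
  "bimodal_I_solution a1 a2 c K2 n m K1 \<longleftrightarrow>
     (let T = bi_T a1 a2 K2 n m K1; T1 = bi_T1 a1 a2 K2 n m K1;
          T2 = bi_T2 a1 a2 K2 n m K1; \<theta> = bi_theta a1 a2 K2 n m K1
      in K1 > 1 \<and> bi_denom K2 n m K1 \<noteq> 0 \<and> T1 \<noteq> 0 \<and> T2 > 0 \<and>
         \<theta> \<in> {0 <..< 1 - 1 / K1} \<and>
         K2 / (K1 - 1) * T2 < \<theta> * T1 \<and> \<theta> * T1 < T1 - 1 / K2 * T2 \<and>
         T > 0 \<and>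
         (\<exists>\<mu>0 \<mu>1 \<mu>2. periodic_singular_solution a1 a2 c K1 K2
            (bi_curve a1 c n T1 T2 \<theta>) UNIV \<mu>0 \<mu>1 \<mu>2 T))"

section \<open>Limits of families of profiles\<close>

text \<open>
  Uniform convergence is required on compact parameter sets only: over the whole line it fails
  as soon as the period varies with \<open>K1\<close>, because \<open>t\<close> grows linearly.
\<close>

definition limiting_profile ::
    "(real \<Rightarrow> real \<Rightarrow> real \<times> real) \<Rightarrow> real filter \<Rightarrow> (real \<Rightarrow> real \<times> real) \<Rightarrow> bool" where
  "limiting_profile \<Gamma> Flt L \<longleftrightarrow> (\<forall>S. compact S \<longrightarrow> uniform_limit S \<Gamma> L Flt)"

end

theory Submission
  imports Defs
begin

text \<open>
  The idea is to describe a profile by the two times \<open>t\<close> and \<open>w = t - a1 - c u\<close>, the first delayed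
  time; the second delayed time is \<open>w - (a2 - a1)\<close>.  On the slopes of the profiles at hand \<open>t\<close>
  grows and \<open>w\<close> is constant; on the vertical edges it is the other way round.  A profile is therefore a
  monotone staircase in the \<open>(t, w)\<close>-plane, and \<open>\<mu>1\<close> and \<open>\<mu>2\<close> have to run along the same staircase so
  that their \<open>t\<close> equals the \<open>w\<close> of \<open>\<mu>0\<close>, up to the shift by \<open>a2 - a1\<close>.  Since \<open>w\<close> stands still
  while \<open>\<mu>0\<close> climbs a slope, the delayed points may slide down vertical edges meanwhile; whenever a
  delayed point has to fall while \<open>\<mu>0\<close> is on a vertical edge, \<open>\<mu>0\<close> pauses.  All these motions are
  piecewise linear, so the delay relations, \<open>F = 0\<close> on slopes and \<open>F < 0\<close> on drops need only be checked
  at the vertices of one period (locale \<open>staircase_solution\<close>): five vertices for the unimodal solution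
  (\<open>unimodal_periodic_solution\<close>), ten for the bimodal one (\<open>bimodal_periodic_solution\<close>).  The period is
  the least one because \<open>u\<close> attains its maximum once per period.

  The rest is the behaviour near the root \<open>M\<close>.  With \<open>S = 1 + K1 + K2\<close> and \<open>b = A - 1\<close>, the unimodal
  \<open>\<theta>\<close> satisfies \<open>(S - 2) \<theta> - K2 = - G / (S + b K2)\<close>, so its lower bound is the condition \<open>G < 0\<close>
  (\<open>uni_theta_G\<close>).  The denominator of \<open>T2\<close> is negative near \<open>M\<close> (\<open>bi_denom_neg\<close>), so \<open>T2 > 0\<close> is the
  condition \<open>G < 0\<close> as well, and it holds just to the left of \<open>M\<close>.  The two periods differ by a multiple
  of \<open>T2\<close> (\<open>bi_balance\<close>).  Hence at \<open>M\<close>, where \<open>T2 = 0\<close>, both periods agree and both \<open>\<theta>\<close> equal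
  \<open>K2 / (M + K2 - 1)\<close> (\<open>at_M\<close>).  All other requirements on the two solutions are strict inequalities
  that hold at \<open>M\<close> and persist nearby by continuity.

  The range of \<open>m\<close> enters through the position of \<open>M\<close>.  With \<open>p = m - n b > 0\<close>, the bound
  \<open>m < m_dagger\<close> means \<open>b > 1 + p (2 + K2)\<close> and \<open>b > p (3 + K2)\<close>.  The first inequality makes \<open>G\<close>
  negative at \<open>1 + 1 / p\<close>; hence \<open>G\<close> has real roots, \<open>M > 1 + 1 / p\<close>, and the denominator of \<open>T2\<close> is
  negative.  Together they give \<open>(M - 1)\<^sup>2 > K2\<close>, which is the inequality \<open>\<theta> < 1 - 1 / M\<close>.
\<close>

section \<open>Piecewise linear interpolation\<close>

definition interp :: "(int \<Rightarrow> real) \<Rightarrow> real \<Rightarrow> real" where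
  "interp y x = y \<lfloor>x\<rfloor> + frac x * (y (\<lfloor>x\<rfloor> + 1) - y \<lfloor>x\<rfloor>)"

lemma interp_on_edge:
  assumes "of_int l \<le> x" "x \<le> of_int l + 1"
  shows "interp y x = y l + (x - of_int l) * (y (l + 1) - y l)"
proof (cases "x = of_int l + 1")
  case True
  then have "\<lfloor>x\<rfloor> = l + 1" "frac x = 0" by (simp_all add: frac_def)
  with True show ?thesis by (simp add: interp_def)
next
  case False
  with assms have "\<lfloor>x\<rfloor> = l" by (intro floor_unique) auto
  then show ?thesis by (simp add: interp_def frac_def)
qed

lemma interp_of_int [simp]: "interp y (of_int l) = y l"
  by (simp add: interp_def)

lemma interp_1 [simp]: "interp y 1 = y 1"
  using interp_of_int[of y 1] by simp

lemma interp_add: "interp (\<lambda>k. y k + z k) x = interp y x + interp z x"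
  by (simp add: interp_def algebra_simps)

lemma interp_diff: "interp (\<lambda>k. y k - z k) x = interp y x - interp z x"
  by (simp add: interp_def algebra_simps)

lemma interp_cmult: "interp (\<lambda>k. a * y k) x = a * interp y x"
  by (simp add: interp_def algebra_simps)

lemma interp_const: "interp (\<lambda>k. a) x = a"
  by (simp add: interp_def)

lemma interp_shift:
  assumes "\<And>k. y (k + P) = y k + q"
  shows "interp y (x + of_int P) = interp y x + q"
proof -
  have "y (\<lfloor>x\<rfloor> + P + 1) = y (\<lfloor>x\<rfloor> + 1) + q"
    using assms[of "\<lfloor>x\<rfloor> + 1"] by (simp add: algebra_simps)
  then show ?thesis by (simp add: interp_def assms frac_def)
qed

lemma shift_multiple:
  fixes f :: "int \<Rightarrow> real"
  assumes "\<And>k. f (k + P) = f k + q"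
  shows "f (k + P * j) = f k + of_int j * q"
proof (induction j rule: int_induct[where k = 0])
  case base show ?case by simp
next
  case (step1 i)
  then show ?case using assms[of "k + P * i"] by (simp add: algebra_simps)
next
  case (step2 i)
  then show ?case using assms[of "k + P * (i - 1)"] by (simp add: algebra_simps)
qed

lemma interp_shift_multiple:
  assumes "\<And>k. y (k + P) = y k + q"
  shows "interp y (x + of_int P * of_int j) = interp y x + of_int j * q"
  using interp_shift[of y "P * j" "of_int j * q" x] shift_multiple[of y P q, OF assms] by simp

lemma continuous_on_interp [continuous_intros]:
  "continuous_on S (interp y)"
proof -
  have edge: "continuous_on {of_int l..of_int l + 1} (interp y)" for l
    by (rule continuous_on_eq[where f = "\<lambda>x. y l + (x - of_int l) * (y (l + 1) - y l)"])
       (auto intro!: continuous_intros simp: interp_on_edge)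
  have "isCont (interp y) x" for x
  proof -
    define l where "l = \<lfloor>x\<rfloor>"
    have "{of_int (l - 1)..of_int (l - 1) + 1} \<union> {of_int l..of_int l + 1}
          = {of_int l - 1..of_int l + (1::real)}" by auto
    then have "continuous_on {of_int l - 1..of_int l + (1::real)} (interp y)"
      using continuous_on_closed_Un[OF closed_atLeastAtMost closed_atLeastAtMost edge edge]
      by metis
    moreover have "x \<in> interior {of_int l - 1..of_int l + (1::real)}"
      unfolding l_def by (simp, linarith)
    ultimately show ?thesis by (rule continuous_on_interior)
  qed
  then show ?thesis by (simp add: continuous_at_imp_continuous_on)
qed

lemma int_step_mono:
  fixes y :: "int \<Rightarrow> real"
  assumes "\<And>k. y k \<le> y (k + 1)" and "i \<le> j"
  shows "y i \<le> y j"
  using \<open>i \<le> j\<close>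
  by (induction j rule: int_ge_induct) (use assms(1) in \<open>auto intro: order_trans\<close>)

text \<open>
  On an edge the interpolation is a convex combination of the two end values.
\<close>

lemma interp_between:
  assumes "a \<le> y \<lfloor>x\<rfloor>" "a \<le> y (\<lfloor>x\<rfloor> + 1)" "y \<lfloor>x\<rfloor> \<le> b" "y (\<lfloor>x\<rfloor> + 1) \<le> b"
  shows "a \<le> interp y x" "interp y x \<le> b"
proof -
  have e: "interp y x = (1 - frac x) * y \<lfloor>x\<rfloor> + frac x * y (\<lfloor>x\<rfloor> + 1)"
    by (simp add: interp_def algebra_simps)
  have f: "0 \<le> frac x" "0 \<le> 1 - frac x" using frac_lt_1[of x] by simp_all
  have "(1 - frac x) * a + frac x * a \<le> interp y x"
    unfolding e using f assms by (intro add_mono mult_left_mono)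
  then show "a \<le> interp y x" by (simp add: algebra_simps)
  have "interp y x \<le> (1 - frac x) * b + frac x * b"
    unfolding e using f assms by (intro add_mono mult_left_mono)
  then show "interp y x \<le> b" by (simp add: algebra_simps)
qed

lemma mono_interp:
  assumes step: "\<And>k. y k \<le> y (k + 1)" and "x \<le> x'"
  shows "interp y x \<le> interp y x'"
proof (cases "\<lfloor>x\<rfloor> = \<lfloor>x'\<rfloor>")
  case True
  with \<open>x \<le> x'\<close> step[of "\<lfloor>x\<rfloor>"] show ?thesis
    by (simp add: interp_def frac_def mult_right_mono)
next
  case False
  then have "\<lfloor>x\<rfloor> + 1 \<le> \<lfloor>x'\<rfloor>" using floor_mono[OF \<open>x \<le> x'\<close>] by simp
  then have "y (\<lfloor>x\<rfloor> + 1) \<le> y \<lfloor>x'\<rfloor>" by (rule int_step_mono[where y = y, OF step])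
  moreover have "interp y x \<le> y (\<lfloor>x\<rfloor> + 1)"
    by (rule interp_between(2)[where a = "y \<lfloor>x\<rfloor>"]) (simp_all add: step)
  moreover have "y \<lfloor>x'\<rfloor> \<le> interp y x'"
    by (rule interp_between(1)[where b = "y (\<lfloor>x'\<rfloor> + 1)"]) (simp_all add: step)
  ultimately show ?thesis by linarith
qed

lemma strict_mono_interp:
  assumes step: "\<And>k. y k < y (k + 1)" and "x < x'"
  shows "interp y x < interp y x'"
proof (cases "\<lfloor>x\<rfloor> = \<lfloor>x'\<rfloor>")
  case True
  with \<open>x < x'\<close> step[of "\<lfloor>x\<rfloor>"] show ?thesis
    by (simp add: interp_def frac_def)
next
  case False
  have step': "y k \<le> y (k + 1)" for k using step[of k] by simp
  from False have "\<lfloor>x\<rfloor> + 1 \<le> \<lfloor>x'\<rfloor>" using floor_mono[of x x'] \<open>x < x'\<close> by simp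
  then have "y (\<lfloor>x\<rfloor> + 1) \<le> y \<lfloor>x'\<rfloor>" by (rule int_step_mono[where y = y, OF step'])
  moreover have "y \<lfloor>x'\<rfloor> \<le> interp y x'"
    by (rule interp_between(1)[where b = "y (\<lfloor>x'\<rfloor> + 1)"]) (simp_all add: step')
  moreover have "interp y x < y (\<lfloor>x\<rfloor> + 1)"
  proof -
    have "frac x * (y (\<lfloor>x\<rfloor> + 1) - y \<lfloor>x\<rfloor>) < 1 * (y (\<lfloor>x\<rfloor> + 1) - y \<lfloor>x\<rfloor>)"
      using frac_lt_1[of x] step[of "\<lfloor>x\<rfloor>"] by (intro mult_strict_right_mono) auto
    then show ?thesis by (simp add: interp_def)
  qed
  ultimately show ?thesis by linarith
qed

text \<open>
  Without the common edge the composition would acquire new corners between the integers; with it,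
  both sides are affine on the edge, so an identity between compositions can be checked at integers.
\<close>

lemma interp_interp:
  assumes "\<exists>l. of_int l \<le> x \<lfloor>\<eta>\<rfloor> \<and> x \<lfloor>\<eta>\<rfloor> \<le> of_int l + 1 \<and>
               of_int l \<le> x (\<lfloor>\<eta>\<rfloor> + 1) \<and> x (\<lfloor>\<eta>\<rfloor> + 1) \<le> of_int l + 1"
  shows "interp y (interp x \<eta>) = interp (\<lambda>k. interp y (x k)) \<eta>"
proof -
  from assms obtain l where l: "of_int l \<le> x \<lfloor>\<eta>\<rfloor>" "x \<lfloor>\<eta>\<rfloor> \<le> of_int l + 1"
      "of_int l \<le> x (\<lfloor>\<eta>\<rfloor> + 1)" "x (\<lfloor>\<eta>\<rfloor> + 1) \<le> of_int l + 1" by blast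
  then have "of_int l \<le> interp x \<eta>" "interp x \<eta> \<le> of_int l + 1"
    using interp_between[of "of_int l" x \<eta> "of_int l + 1"] by simp_all
  from interp_on_edge[OF this, of y]
  have "interp y (interp x \<eta>) = y l + (interp x \<eta> - of_int l) * (y (l + 1) - y l)" .
  also have "\<dots> = interp (\<lambda>k. interp y (x k)) \<eta>"
    unfolding interp_def[of "\<lambda>k. interp y (x k)"]
      interp_on_edge[OF l(1,2), of y] interp_on_edge[OF l(3,4), of y]
    by (simp add: interp_def[of x] algebra_simps)
  finally show ?thesis .
qed

text \<open>
  A compact set meets finitely many edges, and on an edge the deviation of two interpolations is at
  most the larger deviation at its ends.
\<close>

lemma uniform_limit_interp:
  assumes lim: "\<And>k. ((\<lambda>K. y K k) \<longlongrightarrow> z k) F" and "compact S"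
  shows "uniform_limit S (\<lambda>K. interp (y K)) (interp z) F"
proof (rule uniform_limitI)
  fix e :: real assume "e > 0"
  obtain B where B: "\<And>x. x \<in> S \<Longrightarrow> \<bar>x\<bar> \<le> B"
    using compact_imp_bounded[OF \<open>compact S\<close>] unfolding bounded_iff by auto
  define N where "N = {\<lfloor>-B\<rfloor>..\<lfloor>B\<rfloor> + 1}"
  have "\<forall>\<^sub>F K in F. \<forall>k\<in>N. dist (y K k) (z k) < e / 2"
    using tendstoD[OF lim, of "e / 2"] \<open>e > 0\<close> unfolding N_def by (subst eventually_ball_finite_distrib) auto
  then show "\<forall>\<^sub>F K in F. \<forall>x\<in>S. dist (interp (y K) x) (interp z x) < e"
  proof (rule eventually_mono, intro ballI)
    fix K x assume K: "\<forall>k\<in>N. dist (y K k) (z k) < e / 2" and "x \<in> S"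
    have "- B \<le> x" "x \<le> B" using B[OF \<open>x \<in> S\<close>] by auto
    then have "\<lfloor>x\<rfloor> \<in> N" "\<lfloor>x\<rfloor> + 1 \<in> N" unfolding N_def
      using floor_mono[of "-B" x] floor_mono[of x B] by auto
    with K have "\<bar>y K \<lfloor>x\<rfloor> - z \<lfloor>x\<rfloor>\<bar> \<le> e/2" "\<bar>y K (\<lfloor>x\<rfloor>+1) - z (\<lfloor>x\<rfloor>+1)\<bar> \<le> e/2"
      by (auto simp: dist_real_def less_imp_le)
    then have "- (e/2) \<le> interp (\<lambda>k. y K k - z k) x" "interp (\<lambda>k. y K k - z k) x \<le> e/2"
      by (intro interp_between[of "-(e/2)" "\<lambda>k. y K k - z k" x "e/2"]; linarith)+
    with \<open>e > 0\<close> show "dist (interp (y K) x) (interp z x) < e"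
      by (auto simp: dist_real_def interp_diff)
  qed
qed

text \<open>
  The drift makes the values at integers unbounded in both directions, and the range is connected.
\<close>

lemma surj_interp:
  assumes "\<And>k. y (k + P) = y k + q" "q > 0"
  shows "surj (interp y)"
proof -
  have "\<exists>x. interp y x = v" for v
  proof -
    obtain j :: int where j: "y 0 + of_int j * q \<ge> v"
    proof
      have "(v - y 0) / q \<le> of_int \<lceil>(v - y 0) / q\<rceil>" by (rule le_of_int_ceiling)
      then show "y 0 + of_int \<lceil>(v - y 0) / q\<rceil> * q \<ge> v"
        unfolding pos_divide_le_eq[OF \<open>q > 0\<close>] by linarith
    qed
    obtain i :: int where i: "y 0 + of_int i * q \<le> v"
    proof
      have "of_int \<lfloor>(v - y 0) / q\<rfloor> \<le> (v - y 0) / q" by (rule of_int_floor_le)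
      then show "y 0 + of_int \<lfloor>(v - y 0) / q\<rfloor> * q \<le> v"
        unfolding pos_le_divide_eq[OF \<open>q > 0\<close>] by linarith
    qed
    have "interp y (of_int (P * i)) \<le> v" "v \<le> interp y (of_int (P * j))"
      using i j shift_multiple[of y P q 0, OF assms(1)] by (simp_all only: interp_of_int) simp_all
    moreover have "connected (range (interp y))"
      by (intro connected_continuous_image continuous_on_interp) simp
    ultimately have "v \<in> range (interp y)"
      using connected_contains_Icc[OF _ rangeI rangeI] by (meson atLeastAtMost_iff subsetD)
    then show ?thesis by auto
  qed
  then show ?thesis unfolding surj_def by metis
qed

section \<open>Reduction to one period\<close>

lemma all_of_period:
  fixes P :: int
  assumes "P > 0" and shift: "\<And>k. \<Phi> (k + P) \<longleftrightarrow> \<Phi> k"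
    and base: "\<And>k. 0 \<le> k \<Longrightarrow> k < P \<Longrightarrow> \<Phi> k"
  shows "\<Phi> k"
proof -
  have "\<Phi> (r + P * j) \<longleftrightarrow> \<Phi> r" for r j
  proof (induction j rule: int_induct[where k = 0])
    case base show ?case by simp
  next
    case (step1 i)
    then show ?case using shift[of "r + P * i"] by (simp add: algebra_simps)
  next
    case (step2 i)
    then show ?case using shift[of "r + P * (i - 1)"] by (simp add: algebra_simps)
  qed
  from this[of "k mod P" "k div P"] base[of "k mod P"] \<open>P > 0\<close> show ?thesis by simp
qed

section \<open>Staircase profiles\<close>

text \<open>
  A profile is recorded by the two times \<open>t\<close> and \<open>w = t - a1 - c u\<close>, the first delayed time,
  instead of by \<open>t\<close> and \<open>u\<close>: in the sawtooth profiles exactly one of \<open>t\<close> and \<open>w\<close> advances on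
  each edge.
\<close>

definition staircase_curve ::
    "real \<Rightarrow> real \<Rightarrow> (int \<Rightarrow> real) \<Rightarrow> (int \<Rightarrow> real) \<Rightarrow> real \<Rightarrow> real \<times> real" where
  "staircase_curve a1 c p w \<mu> = (interp p \<mu>, (interp p \<mu> - a1 - interp w \<mu>) / c)"

definition slopes :: "real set" where
  "slopes = (\<Union>i::int. {2 * of_int i <..< 2 * of_int i + 1})"

definition drops :: "real set" where
  "drops = (\<Union>i::int. {2 * of_int i + 1 .. 2 * of_int i + 2})"

lemma drops_eq_Compl_slopes: "drops = - slopes"
proof (rule set_eqI)
  fix x :: real
  define i where "i = \<lfloor>x / 2\<rfloor>"
  have "of_int i \<le> x / 2" "x / 2 < of_int i + 1" unfolding i_def by linarith+
  then have i: "2 * of_int i \<le> x" "x < 2 * of_int i + 2" by auto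
  have slope: "x \<in> slopes \<longleftrightarrow> 2 * of_int i < x \<and> x < 2 * of_int i + 1"
  proof
    assume "x \<in> slopes"
    then obtain j :: int where j: "2 * of_int j < x" "x < 2 * of_int j + 1" by (auto simp: slopes_def)
    with i have "of_int j < (of_int (i + 1) :: real)" "of_int i < (of_int (j + 1) :: real)" by simp_all
    then have "j = i" unfolding of_int_less_iff by simp
    with j show "2 * of_int i < x \<and> x < 2 * of_int i + 1" by simp
  qed (auto simp: slopes_def)
  have drop: "x \<in> drops \<longleftrightarrow> x = 2 * of_int i \<or> 2 * of_int i + 1 \<le> x"
  proof
    assume "x \<in> drops"
    then obtain j :: int where j: "2 * of_int j + 1 \<le> x" "x \<le> 2 * of_int j + 2" by (auto simp: drops_def)
    show "x = 2 * of_int i \<or> 2 * of_int i + 1 \<le> x"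
    proof (cases "x = 2 * of_int j + 2")
      case True
      with i have "of_int j < (of_int i :: real)" "of_int i < (of_int (j + 2) :: real)" by simp_all
      then have "i = j + 1" unfolding of_int_less_iff by simp
      with True show ?thesis by simp
    next
      case False
      with i j have "of_int j < (of_int (i + 1) :: real)" "of_int i < (of_int (j + 1) :: real)" by simp_all
      then have "j = i" unfolding of_int_less_iff by simp
      with j show ?thesis by simp
    qed
  next
    assume "x = 2 * of_int i \<or> 2 * of_int i + 1 \<le> x"
    then show "x \<in> drops"
    proof
      assume "x = 2 * of_int i"
      then have "x \<in> {2 * of_int (i - 1) + 1 .. 2 * of_int (i - 1) + 2}" by simp
      then show ?thesis unfolding drops_def by blast
    next
      assume "2 * of_int i + 1 \<le> x"
      with i have "x \<in> {2 * of_int i + 1 .. 2 * of_int i + 2}" by simp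
      then show ?thesis unfolding drops_def by blast
    qed
  qed
  show "x \<in> drops \<longleftrightarrow> x \<in> - slopes" using slope drop i by auto
qed

text \<open>
  The half-open windows of length 2 are disjoint, which separates the sets \<open>X i\<close>.
\<close>

lemma partition_on_range_intervals:
  fixes X :: "int \<Rightarrow> real set"
  assumes "\<And>i. X i \<noteq> {}"
    and "\<And>i. X i \<subseteq> {2 * of_int i + a ..< 2 * of_int i + a + 2}"
  shows "partition_on (\<Union>i. X i) (range X)"
proof (rule partition_onI)
  fix Y Z assume "Y \<in> range X" "Z \<in> range X" "Y \<noteq> Z"
  then obtain i j where ij: "Y = X i" "Z = X j" "i \<noteq> j" by auto
  have False if "x \<in> X i" "x \<in> X j" for x
  proof -
    from that assms(2)[of i] assms(2)[of j]
    have "2 * of_int i + a \<le> x" "x < 2 * of_int i + a + 2" "2 * of_int j + a \<le> x" "x < 2 * of_int j + a + 2"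
      by (auto simp: subset_iff)
    then have "of_int i < (of_int (j + 1) :: real)" "of_int j < (of_int (i + 1) :: real)" by simp_all
    with \<open>i \<noteq> j\<close> show False unfolding of_int_less_iff by simp
  qed
  then show "disjnt Y Z" by (auto simp: ij disjnt_def)
qed (use assms(1) in auto)

text \<open>
  Even edges are slopes, odd edges are vertical.  The last two assumptions say that \<open>c u + a1\<close>, which
  is \<open>p - w\<close>, attains its maximum over the odd vertices only at vertex 1 and its translates; this is
  what makes \<open>T\<close> the least period.
\<close>

locale staircase =
  fixes p w :: "int \<Rightarrow> real" and Q :: int and T a1 c :: real
  assumes c_pos: "0 < c" and T_pos: "0 < T" and Q_even: "even Q" and Q_pos: "0 < Q"
    and p_shift: "p (l + Q) = p l + T" and w_shift: "w (l + Q) = w l + T"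
    and slope: "even l \<Longrightarrow> p l < p (l + 1) \<and> w (l + 1) = w l"
    and drop: "odd l \<Longrightarrow> p (l + 1) = p l \<and> w l < w (l + 1)"
    and top: "odd l \<Longrightarrow> p l - w l \<le> p 1 - w 1"
    and top_eq: "odd l \<Longrightarrow> p l - w l = p 1 - w 1 \<Longrightarrow> Q dvd l - 1"
begin

abbreviation "\<Gamma> \<equiv> staircase_curve a1 c p w"

lemma mono_p: "x \<le> y \<Longrightarrow> interp p x \<le> interp p y"
  using slope drop by (intro mono_interp) (metis less_imp_le order_refl)

text \<open>
  Injectivity holds because \<open>t + w\<close> is a function of the point and strictly increases along the curve.
\<close>

lemma admissible_staircase: "admissible_profile \<Gamma> UNIV {} drops slopes"
proof -
  have inj: "inj_on \<Gamma> UNIV"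
  proof (rule injI)
    fix x y assume "\<Gamma> x = \<Gamma> y"
    then have "interp (\<lambda>k. p k + w k) x = interp (\<lambda>k. p k + w k) y"
      using c_pos by (simp add: staircase_curve_def interp_add)
    moreover have "p k + w k < p (k + 1) + w (k + 1)" for k
      using slope[of k] drop[of k] by (cases "even k") auto
    note strict_mono_interp[of "\<lambda>k. p k + w k", OF this]
    ultimately show "x = y" by (metis linorder_neqE_linordered_idom less_irrefl)
  qed
  have cont: "continuous_on UNIV \<Gamma>"
    unfolding staircase_curve_def using c_pos by (intro continuous_intros) auto
  have slopes_part: "\<exists>C. partition_on slopes C \<and>
      (\<forall>X\<in>C. is_interval X \<and> open X \<and> strict_mono_on X (\<lambda>\<mu>. fst (\<Gamma> \<mu>)))"
  proof (intro exI conjI ballI)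
    show "partition_on slopes (range (\<lambda>i::int. {2 * of_int i <..< 2 * of_int i + (1::real)}))"
      unfolding slopes_def by (rule partition_on_range_intervals[where a = 0]) auto
    fix X assume "X \<in> range (\<lambda>i::int. {2 * of_int i <..< 2 * of_int i + (1::real)})"
    then obtain i :: int where X: "X = {2 * of_int i <..< 2 * of_int i + 1}" by auto
    show "is_interval X" "open X" by (simp_all add: X is_interval_oo)
    show "strict_mono_on X (\<lambda>\<mu>. fst (\<Gamma> \<mu>))"
    proof (rule strict_mono_onI)
      fix x y assume "x \<in> X" "y \<in> X" "x < y"
      moreover have "p (2 * i) < p (2 * i + 1)" using slope[of "2 * i"] by simp
      ultimately show "fst (\<Gamma> x) < fst (\<Gamma> y)"
        using interp_on_edge[of "2 * i" x p] interp_on_edge[of "2 * i" y p]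
        by (simp add: X staircase_curve_def)
    qed
  qed
  have drops_part: "\<exists>C. partition_on drops C \<and>
      (\<forall>X\<in>C. is_interval X \<and> closed X \<and> interior X \<noteq> {} \<and>
         (\<lambda>\<mu>. fst (\<Gamma> \<mu>)) constant_on X \<and> strict_antimono_on X (\<lambda>\<mu>. snd (\<Gamma> \<mu>)))"
  proof (intro exI conjI ballI)
    show "partition_on drops (range (\<lambda>i::int. {2 * of_int i + 1 .. 2 * of_int i + (2::real)}))"
      unfolding drops_def by (rule partition_on_range_intervals[where a = 1]) auto
    fix X assume "X \<in> range (\<lambda>i::int. {2 * of_int i + 1 .. 2 * of_int i + (2::real)})"
    then obtain i :: int where X: "X = {2 * of_int i + 1 .. 2 * of_int i + 2}" by auto
    show "is_interval X" "closed X" "interior X \<noteq> {}" by (simp_all add: X is_interval_cc)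
    have d: "p (2 * i + 2) = p (2 * i + 1)" "w (2 * i + 1) < w (2 * i + 2)"
      using drop[of "2 * i + 1"] by (simp_all add: add.assoc)
    have e: "interp y x = y (2 * i + 1) + (x - (2 * of_int i + 1)) * (y (2 * i + 2) - y (2 * i + 1))"
      if "x \<in> X" for x y
      using interp_on_edge[of "2 * i + 1" x y] that by (simp add: X add.assoc)
    show "(\<lambda>\<mu>. fst (\<Gamma> \<mu>)) constant_on X"
      unfolding constant_on_def by (auto simp: staircase_curve_def e d)
    show "strict_antimono_on X (\<lambda>\<mu>. snd (\<Gamma> \<mu>))"
    proof (rule monotone_onI)
      fix x y assume "x \<in> X" "y \<in> X" "x < y"
      with d c_pos show "snd (\<Gamma> y) < snd (\<Gamma> x)"
        by (simp add: staircase_curve_def e divide_strict_right_mono)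
    qed
  qed
  show ?thesis
    unfolding admissible_profile_def
    using inj cont slopes_part drops_part
    by (auto simp: is_interval_univ drops_eq_Compl_slopes monotone_on_def staircase_curve_def
        intro!: mono_p exI[of _ "{}"] simp: partition_on_def)
qed

lemma height_le_top: "p l - w l \<le> p 1 - w 1"
proof (cases "even l")
  case True
  with slope[of l] top[of "l + 1"] show ?thesis by simp
qed (rule top)

text \<open>
  Away from vertices the height is a proper average of two neighbouring vertex heights, and one of the
  two is even, hence lower than the next odd one.
\<close>

lemma height_eq_topD:
  assumes "interp p x - interp w x = p 1 - w 1"
  shows "\<exists>i::int. x = 1 + of_int Q * of_int i"
proof -
  have lower: "p l - w l < p 1 - w 1" if "even l" for l
    using slope[of l] top[of "l + 1"] that by simp
  have *: "\<exists>i::int. x = 1 + of_int Q * of_int i" if t: "p \<lfloor>x\<rfloor> - w \<lfloor>x\<rfloor> = p 1 - w 1" and f: "frac x = 0"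
  proof -
    have "odd \<lfloor>x\<rfloor>" using lower[of "\<lfloor>x\<rfloor>"] t by auto
    from top_eq[OF this t] obtain i where "\<lfloor>x\<rfloor> - 1 = Q * i" by (elim dvdE)
    then have "\<lfloor>x\<rfloor> = 1 + Q * i" by simp
    then have "of_int \<lfloor>x\<rfloor> = 1 + of_int Q * (of_int i :: real)" by simp
    with f show ?thesis by (intro exI[of _ i]) (simp add: frac_def)
  qed
  show ?thesis
  proof (cases "frac x = 0")
    case True
    with assms show ?thesis by (intro *) (simp_all add: interp_def)
  next
    case False
    define f where "f = frac x"
    have f: "0 < f" "f < 1" using False frac_lt_1[of x] frac_ge_0[of x] unfolding f_def by linarith+
    define A B where "A = p \<lfloor>x\<rfloor> - w \<lfloor>x\<rfloor>" and "B = p (\<lfloor>x\<rfloor> + 1) - w (\<lfloor>x\<rfloor> + 1)"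
    have AB: "(1 - f) * A + f * B = p 1 - w 1"
      using assms by (simp add: interp_def A_def B_def f_def algebra_simps)
    have le: "A \<le> p 1 - w 1" "B \<le> p 1 - w 1" unfolding A_def B_def by (rule height_le_top)+
    have "A < p 1 - w 1 \<or> B < p 1 - w 1"
      using lower[of "\<lfloor>x\<rfloor>"] lower[of "\<lfloor>x\<rfloor> + 1"] unfolding A_def B_def by (cases "even \<lfloor>x\<rfloor>") auto
    then have "(1 - f) * A + f * B < (1 - f) * (p 1 - w 1) + f * (p 1 - w 1)"
    proof
      assume "A < p 1 - w 1"
      with f le(2) show ?thesis
        by (intro add_less_le_mono mult_left_mono mult_strict_left_mono) simp_all
    next
      assume "B < p 1 - w 1"
      with f le(1) show ?thesis
        by (intro add_le_less_mono mult_left_mono mult_strict_left_mono) simp_all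
    qed
    with AB show ?thesis by (simp add: algebra_simps)
  qed
qed

end


text \<open>
  The vertex data of a periodic singular solution.  Between consecutive integers \<open>\<eta>\<close> each of
  \<open>\<mu>0, \<mu>1, \<mu>2\<close> moves along a single edge of the staircase (or pauses), so that the delay relations
  and the sign conditions reduce to their values at the integers of one period.  \<open>S k\<close> marks the
  steps on which \<open>\<mu>0\<close> runs along a slope, and \<open>F\<close> is \<open>c\<close> times the function \<open>F\<close> of a singular
  solution.
\<close>

locale staircase_solution = staircase p w Q T a1 c
  for p w :: "int \<Rightarrow> real" and Q :: int and T a1 c :: real +
  fixes a2 K1 K2 :: real and P :: int and S :: "int \<Rightarrow> bool" and x0 x1 x2 F :: "int \<Rightarrow> real"
  assumes P_pos: "0 < P" and S_shift: "S (k + P) \<longleftrightarrow> S k"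
    and x0_shift: "x0 (k + P) = x0 k + of_int Q"
    and x1_shift: "x1 (k + P) = x1 k + of_int Q"
    and x2_shift: "x2 (k + P) = x2 k + of_int Q"
    and edge0: "0 \<le> k \<Longrightarrow> k < P \<Longrightarrow> \<exists>l. if S k
        then even l \<and> x0 k = of_int l \<and> x0 (k + 1) = of_int l + 1
        else odd l \<and> of_int l \<le> x0 k \<and> x0 k \<le> x0 (k + 1) \<and> x0 (k + 1) \<le> of_int l + 1"
    and edge1: "0 \<le> k \<Longrightarrow> k < P \<Longrightarrow>
        \<exists>l. {x1 k, x1 (k + 1)} \<subseteq> {of_int l .. of_int l + 1}"
    and edge2: "0 \<le> k \<Longrightarrow> k < P \<Longrightarrow>
        \<exists>l. {x2 k, x2 (k + 1)} \<subseteq> {of_int l .. of_int l + 1}"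
    and delay1: "0 \<le> k \<Longrightarrow> k < P \<Longrightarrow> interp p (x1 k) = interp w (x0 k)"
    and delay2: "0 \<le> k \<Longrightarrow> k < P \<Longrightarrow> interp p (x2 k) = interp w (x0 k) - (a2 - a1)"
    and F_def: "F k = - (interp p (x0 k) - a1 - interp w (x0 k))
        - K1 * (interp p (x1 k) - a1 - interp w (x1 k))
        - K2 * (interp p (x2 k) - a1 - interp w (x2 k))"
    and F_slope: "0 \<le> k \<Longrightarrow> k < P \<Longrightarrow> S k \<Longrightarrow> F k = 0 \<and> F (k + 1) = 0"
    and F_drop: "0 \<le> k \<Longrightarrow> k < P \<Longrightarrow> \<not> S k \<Longrightarrow> \<not> S (k - 1) \<Longrightarrow> F k < 0"
    and S_sparse: "\<not> S k \<Longrightarrow> S (k - 1) \<Longrightarrow> \<not> S (k + 1)"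
begin

lemma shift_next:
  "x0 (k + P + 1) = x0 (k + 1) + of_int Q" "x1 (k + P + 1) = x1 (k + 1) + of_int Q"
  "x2 (k + P + 1) = x2 (k + 1) + of_int Q" "S (k + P - 1) \<longleftrightarrow> S (k - 1)"
  using x0_shift[of "k + 1"] x1_shift[of "k + 1"] x2_shift[of "k + 1"] S_shift[of "k - 1"]
  by (simp_all add: algebra_simps)

lemma F_shift: "F (k + P) = F k"
  unfolding F_def x0_shift x1_shift x2_shift
    interp_shift[where y = p, OF p_shift] interp_shift[where y = w, OF w_shift]
  by (simp add: algebra_simps)

lemma F_shift_next: "F (k + P + 1) = F (k + 1)"
  using F_shift[of "k + 1"] by (simp add: algebra_simps)

lemma ex_shift: "(\<And>l. A l \<longleftrightarrow> B (l - Q)) \<Longrightarrow> (\<exists>l. A l) \<longleftrightarrow> (\<exists>l. B l)"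
  by (metis add_diff_cancel_right')

lemma edge0_all: "\<exists>l. if S k
        then even l \<and> x0 k = of_int l \<and> x0 (k + 1) = of_int l + 1
        else odd l \<and> of_int l \<le> x0 k \<and> x0 k \<le> x0 (k + 1) \<and> x0 (k + 1) \<le> of_int l + 1"
proof (rule all_of_period[OF P_pos _ edge0], goal_cases)
  case (1 k)
  show ?case
    using Q_even unfolding S_shift x0_shift shift_next by (intro ex_shift) (auto split: if_splits)
qed

lemma edge_shift:
  fixes x :: "int \<Rightarrow> real"
  assumes "x (k + P) = x k + of_int Q" "x (k + P + 1) = x (k + 1) + of_int Q"
  shows "(\<exists>l. {x (k + P), x (k + P + 1)} \<subseteq> {of_int l .. of_int l + 1}) \<longleftrightarrow>
         (\<exists>l. {x k, x (k + 1)} \<subseteq> {of_int l .. of_int l + 1})"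
  unfolding assms by (rule ex_shift) (auto simp: algebra_simps)

lemma edge1_all: "\<exists>l. {x1 k, x1 (k + 1)} \<subseteq> {of_int l .. of_int l + 1}"
  by (rule all_of_period[OF P_pos _ edge1]) (simp_all only: edge_shift[OF x1_shift shift_next(2)])

lemma edge2_all: "\<exists>l. {x2 k, x2 (k + 1)} \<subseteq> {of_int l .. of_int l + 1}"
  by (rule all_of_period[OF P_pos _ edge2]) (simp_all only: edge_shift[OF x2_shift shift_next(3)])

lemma delay1_all: "interp p (x1 k) = interp w (x0 k)"
  by (rule all_of_period[OF P_pos _ delay1])
    (simp_all add: x0_shift x1_shift
      interp_shift[where y = p, OF p_shift] interp_shift[where y = w, OF w_shift])

lemma delay2_all: "interp p (x2 k) = interp w (x0 k) - (a2 - a1)"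
  by (rule all_of_period[OF P_pos _ delay2])
    (auto simp: x0_shift x2_shift
      interp_shift[where y = p, OF p_shift] interp_shift[where y = w, OF w_shift])

lemma F_slope_all: "S k \<Longrightarrow> F k = 0 \<and> F (k + 1) = 0"
proof -
  have "S k \<longrightarrow> F k = 0 \<and> F (k + 1) = 0"
    by (rule all_of_period[OF P_pos]) (simp_all add: S_shift F_shift F_shift_next F_slope)
  then show "S k \<Longrightarrow> F k = 0 \<and> F (k + 1) = 0" by blast
qed

lemma F_drop_all: "\<not> S k \<Longrightarrow> \<not> S (k - 1) \<Longrightarrow> F k < 0"
proof -
  have "\<not> S k \<longrightarrow> \<not> S (k - 1) \<longrightarrow> F k < 0"
    by (rule all_of_period[OF P_pos]) (simp_all add: S_shift F_shift F_drop shift_next)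
  then show "\<not> S k \<Longrightarrow> \<not> S (k - 1) \<Longrightarrow> F k < 0" by blast
qed

lemma F_nonpos: "\<not> S k \<Longrightarrow> F k \<le> 0" "\<not> S k \<Longrightarrow> F (k + 1) \<le> 0"
  using F_slope_all[of "k - 1"] F_drop_all[of k] F_slope_all[of "k + 1"] F_drop_all[of "k + 1"]
  by (cases "S (k - 1)", simp_all) (cases "S (k + 1)", simp_all)

lemma F_edge_neg: "\<not> S k \<Longrightarrow> F k < 0 \<or> F (k + 1) < 0"
  using F_drop_all[of k] F_drop_all[of "k + 1"] S_sparse[of k] by auto

lemma interp_y_x0: "interp y (interp x0 \<eta>) = interp (\<lambda>k. interp y (x0 k)) \<eta>"
  by (rule interp_interp) (use edge0_all[of "\<lfloor>\<eta>\<rfloor>"] in \<open>fastforce split: if_splits\<close>)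

lemma interp_y_x1: "interp y (interp x1 \<eta>) = interp (\<lambda>k. interp y (x1 k)) \<eta>"
  by (rule interp_interp) (use edge1_all[of "\<lfloor>\<eta>\<rfloor>"] in auto)

lemma interp_y_x2: "interp y (interp x2 \<eta>) = interp (\<lambda>k. interp y (x2 k)) \<eta>"
  by (rule interp_interp) (use edge2_all[of "\<lfloor>\<eta>\<rfloor>"] in auto)

lemma mono_x0: "x \<le> y \<Longrightarrow> interp x0 x \<le> interp x0 y"
proof (rule mono_interp)
  show "x0 k \<le> x0 (k + 1)" for k using edge0_all[of k] by (auto split: if_splits)
qed

lemma F_interp:
  "- snd (\<Gamma> (interp x0 \<eta>)) - K1 * snd (\<Gamma> (interp x1 \<eta>)) - K2 * snd (\<Gamma> (interp x2 \<eta>))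
     = interp F \<eta> / c"
proof -
  define U where "U x k = interp p (x k) - interp w (x k)" for x :: "int \<Rightarrow> real" and k
  have F: "F = (\<lambda>k. a1 * (1 + K1 + K2) - (U x0 k + (K1 * U x1 k + K2 * U x2 k)))"
    by (rule ext) (simp add: F_def U_def algebra_simps)
  have "interp F \<eta> = a1 * (1 + K1 + K2)
      - (interp (U x0) \<eta> + (K1 * interp (U x1) \<eta> + K2 * interp (U x2) \<eta>))"
    unfolding F interp_diff interp_add interp_cmult interp_const by simp
  moreover have "interp (U x0) \<eta> = interp p (interp x0 \<eta>) - interp w (interp x0 \<eta>)"
    "interp (U x1) \<eta> = interp p (interp x1 \<eta>) - interp w (interp x1 \<eta>)"
    "interp (U x2) \<eta> = interp p (interp x2 \<eta>) - interp w (interp x2 \<eta>)"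
    unfolding interp_y_x0 interp_y_x1 interp_y_x2 U_def[abs_def] interp_diff by simp_all
  moreover have height: "c * snd (\<Gamma> x) = interp p x - a1 - interp w x" for x
    using c_pos by (simp add: staircase_curve_def)
  define s0 s1 s2 where "s0 = snd (\<Gamma> (interp x0 \<eta>))" and "s1 = snd (\<Gamma> (interp x1 \<eta>))"
    and "s2 = snd (\<Gamma> (interp x2 \<eta>))"
  have "c * (- s0 - K1 * s1 - K2 * s2) = - (c * s0) - K1 * (c * s1) - K2 * (c * s2)"
    by (simp add: algebra_simps)
  ultimately have "c * (- s0 - K1 * s1 - K2 * s2) = interp F \<eta>"
    unfolding s0_def s1_def s2_def height by (simp add: algebra_simps)
  with c_pos show ?thesis unfolding s0_def s1_def s2_def by (simp add: field_simps)
qed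

lemma on_slope:
  assumes "S \<lfloor>\<eta>\<rfloor>" "0 < frac \<eta>"
  shows "interp x0 \<eta> \<in> slopes"
proof -
  from edge0_all[of "\<lfloor>\<eta>\<rfloor>"] assms(1) obtain l where
    "even l" "x0 \<lfloor>\<eta>\<rfloor> = of_int l" "x0 (\<lfloor>\<eta>\<rfloor> + 1) = of_int l + 1" by auto
  moreover from \<open>even l\<close> obtain i where "l = 2 * i" by (elim evenE)
  ultimately show ?thesis
    using assms(2) frac_lt_1[of \<eta>] by (auto simp: slopes_def interp_def intro!: exI[of _ i])
qed

lemma on_drop:
  assumes "\<not> S \<lfloor>\<eta>\<rfloor>"
  shows "interp x0 \<eta> \<in> drops"
proof -
  from edge0_all[of "\<lfloor>\<eta>\<rfloor>"] assms obtain l where l: "odd l" "of_int l \<le> x0 \<lfloor>\<eta>\<rfloor>"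
    "x0 \<lfloor>\<eta>\<rfloor> \<le> x0 (\<lfloor>\<eta>\<rfloor> + 1)" "x0 (\<lfloor>\<eta>\<rfloor> + 1) \<le> of_int l + 1" by auto
  then have "of_int l \<le> interp x0 \<eta>" "interp x0 \<eta> \<le> of_int l + 1"
    using interp_between[of "of_int l" x0 \<eta> "of_int l + 1"] by simp_all
  moreover from \<open>odd l\<close> obtain i where "l = 2 * i + 1" by (elim oddE)
  ultimately show ?thesis by (auto simp: drops_def intro!: exI[of _ i])
qed

lemma F_zero_on_slopes: "\<eta> \<in> closure {\<eta>. interp x0 \<eta> \<in> slopes} \<Longrightarrow> interp F \<eta> = 0"
proof -
  have "closed {\<eta>. interp F \<eta> = 0}"
    by (intro closed_Collect_eq continuous_on_interp continuous_on_const)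
  moreover have "{\<eta>. interp x0 \<eta> \<in> slopes} \<subseteq> {\<eta>. interp F \<eta> = 0}"
  proof clarify
    fix \<eta> assume "interp x0 \<eta> \<in> slopes"
    with on_drop[of \<eta>] have "S \<lfloor>\<eta>\<rfloor>" by (auto simp: drops_eq_Compl_slopes)
    with F_slope_all[of "\<lfloor>\<eta>\<rfloor>"] show "interp F \<eta> = 0" by (simp add: interp_def)
  qed
  ultimately show "\<eta> \<in> closure {\<eta>. interp x0 \<eta> \<in> slopes} \<Longrightarrow> interp F \<eta> = 0"
    using closure_minimal by blast
qed

text \<open>
  At an integer \<open>\<eta>\<close> interiority excludes a slope on either side, so the vertex value is negative;
  between integers \<open>F\<close> averages two nonpositive vertex values that do not both vanish.
\<close>

lemma F_neg_on_drops:
  assumes "\<eta> \<in> interior {\<eta>. interp x0 \<eta> \<in> drops}"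
  shows "interp F \<eta> < 0"
proof -
  from assms obtain e where "e > 0" and e: "ball \<eta> e \<subseteq> {\<eta>. interp x0 \<eta> \<in> drops}"
    by (auto simp: mem_interior)
  have no_slope: False if "\<bar>\<xi> - \<eta>\<bar> < e" "S \<lfloor>\<xi>\<rfloor>" "0 < frac \<xi>" for \<xi>
    using e that on_slope[of \<xi>] by (auto simp: drops_eq_Compl_slopes dist_real_def abs_minus_commute)
  define f where "f = frac \<eta>"
  have f1: "f < 1" "0 \<le> f" by (simp_all add: f_def frac_lt_1)
  have F: "interp F \<eta> = (1 - f) * F \<lfloor>\<eta>\<rfloor> + f * F (\<lfloor>\<eta>\<rfloor> + 1)"
    by (simp add: interp_def f_def algebra_simps)
  show ?thesis
  proof (cases "0 < f")
    case True
    then have "\<not> S \<lfloor>\<eta>\<rfloor>" using no_slope[of \<eta>] \<open>e > 0\<close> by (auto simp: f_def)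
    note neg = F_nonpos[OF this] F_edge_neg[OF this]
    then have "(1 - f) * F \<lfloor>\<eta>\<rfloor> \<le> 0" "f * F (\<lfloor>\<eta>\<rfloor> + 1) \<le> 0"
      using f1 by (simp_all add: mult_nonneg_nonpos)
    moreover have "(1 - f) * F \<lfloor>\<eta>\<rfloor> < 0 \<or> f * F (\<lfloor>\<eta>\<rfloor> + 1) < 0"
      using neg(3) f1 True mult_pos_neg[of "1 - f" "F \<lfloor>\<eta>\<rfloor>"] mult_pos_neg[of f "F (\<lfloor>\<eta>\<rfloor> + 1)"] by auto
    ultimately show ?thesis unfolding F by linarith
  next
    case False
    define s where "s = min e 1 / 2"
    have s: "0 < s" "s < e" "s < 1" using \<open>e > 0\<close> by (auto simp: s_def)
    from False f1 have \<eta>: "\<eta> = of_int \<lfloor>\<eta>\<rfloor>" "f = 0" unfolding f_def frac_def by linarith+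
    have fl: "\<lfloor>\<eta> + s\<rfloor> = \<lfloor>\<eta>\<rfloor>" "\<lfloor>\<eta> - s\<rfloor> = \<lfloor>\<eta>\<rfloor> - 1"
      using s \<eta>(1) by (simp_all add: floor_eq_iff)
    have fr: "0 < frac (\<eta> + s)" "0 < frac (\<eta> - s)"
      using s \<eta>(1) by (simp_all add: frac_def fl)
    have "\<not> S \<lfloor>\<eta>\<rfloor>" using no_slope[of "\<eta> + s"] s fl fr by auto
    moreover have "\<not> S (\<lfloor>\<eta>\<rfloor> - 1)" using no_slope[of "\<eta> - s"] s fl fr by auto
    ultimately show ?thesis using F_drop_all F \<eta>(2) by simp
  qed
qed

lemma singular: "singular_solution a1 a2 c K1 K2 \<Gamma> UNIV UNIV (interp x0) (interp x1) (interp x2)"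
proof -
  have time: "fst (\<Gamma> x) - a1 - c * snd (\<Gamma> x) = interp w x" for x
    using c_pos by (simp add: staircase_curve_def)
  have "fst (\<Gamma> (interp x1 \<eta>)) = interp w (interp x0 \<eta>)" for \<eta>
    by (simp add: staircase_curve_def interp_y_x0 interp_y_x1 delay1_all)
  moreover have "fst (\<Gamma> (interp x2 \<eta>)) = interp w (interp x0 \<eta>) - (a2 - a1)" for \<eta>
    by (simp add: staircase_curve_def interp_y_x0 interp_y_x2 delay2_all interp_diff interp_const)
  ultimately have delays:
    "fst (\<Gamma> (interp x1 \<eta>)) = fst (\<Gamma> (interp x0 \<eta>)) - a1 - c * snd (\<Gamma> (interp x0 \<eta>))"
    "fst (\<Gamma> (interp x2 \<eta>)) = fst (\<Gamma> (interp x0 \<eta>)) - a2 - c * snd (\<Gamma> (interp x0 \<eta>))" for \<eta>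
    using time[of "interp x0 \<eta>"] by simp_all
  show ?thesis
    unfolding singular_solution_def Let_def
    by (intro exI[of _ "{}"] exI[of _ drops] exI[of _ slopes] conjI)
      (use c_pos in \<open>auto simp: admissible_staircase is_interval_univ F_interp monotone_on_def
        divide_less_0_iff zero_less_divide_iff
        intro!: continuous_on_interp mono_x0 delays F_zero_on_slopes F_neg_on_drops\<close>)
qed

text \<open>
  A translation period moves a point of maximal \<open>u\<close> to another one, so it is a multiple of \<open>T\<close>.
\<close>

theorem periodic:
  "periodic_singular_solution a1 a2 c K1 K2 \<Gamma> UNIV (interp x0) (interp x1) (interp x2) T"
  unfolding periodic_singular_solution_def
proof (intro conjI ballI)
  have "\<Gamma> (x + of_int Q) = (fst (\<Gamma> x) + T, snd (\<Gamma> x))" for x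
    by (simp add: staircase_curve_def
        interp_shift[where y = p, OF p_shift] interp_shift[where y = w, OF w_shift])
  then show "T \<in> translation_periods \<Gamma> (interp x0) (interp x1) (interp x2)"
    unfolding translation_periods_def
    using T_pos P_pos interp_shift[where y = x0, OF x0_shift]
      interp_shift[where y = x1, OF x1_shift] interp_shift[where y = x2, OF x2_shift]
    by (auto intro!: exI[of _ "of_int P"])
next
  fix T' assume "T' \<in> translation_periods \<Gamma> (interp x0) (interp x1) (interp x2)"
  then obtain h where "T' > 0" and h: "\<And>\<eta>. fst (\<Gamma> (interp x0 (\<eta> + h))) = fst (\<Gamma> (interp x0 \<eta>)) + T'"
      "\<And>\<eta>. snd (\<Gamma> (interp x0 (\<eta> + h))) = snd (\<Gamma> (interp x0 \<eta>))"
    unfolding translation_periods_def by auto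
  obtain \<eta> where \<eta>: "interp x0 \<eta> = 1"
    using surj_interp[of x0 P "of_int Q", OF x0_shift] Q_pos by (metis of_int_0_less_iff surjD)
  define x where "x = interp x0 (\<eta> + h)"
  have "interp p x = p 1 + T'" using h(1)[of \<eta>] by (simp add: staircase_curve_def \<eta> x_def)
  moreover have "interp p x - interp w x = p 1 - w 1"
    using h(2)[of \<eta>] c_pos by (simp add: staircase_curve_def \<eta> x_def)
  moreover from height_eq_topD[OF this] obtain i :: int where "x = 1 + of_int Q * of_int i" ..
  ultimately have "T' = of_int i * T"
    using interp_shift_multiple[where y = p and x = 1, OF p_shift, of i] by simp
  with \<open>T' > 0\<close> T_pos have "0 < i" by (simp add: zero_less_mult_iff)
  then have "1 * T \<le> of_int i * T" using T_pos by (intro mult_right_mono) auto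
  with \<open>T' = of_int i * T\<close> show "T \<le> T'" by simp
qed (rule singular)

end

section \<open>The unimodal solution\<close>

text \<open>
  The sequence that runs through \<open>xs\<close> and gains \<open>q\<close> after each full pass.
\<close>

definition drift_seq :: "real \<Rightarrow> real list \<Rightarrow> int \<Rightarrow> real" where
  "drift_seq q xs k = xs ! nat (k mod int (length xs)) + q * of_int (k div int (length xs))"

lemma drift_seq_shift:
  assumes "int (length xs) = P" "0 < P"
  shows "drift_seq q xs (k + P) = drift_seq q xs k + q"
  using assms by (simp add: drift_seq_def algebra_simps)

lemma drift_seq_cell:
  assumes "int (length xs) = P" "0 \<le> r" "r < P"
  shows "drift_seq q xs (P * j + r) = xs ! nat r + q * of_int j"
  using assms by (simp add: drift_seq_def)

lemma drift_seq_2: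
  "drift_seq q [a, b] (2 * i) = a + q * of_int i" "drift_seq q [a, b] (2 * i + 1) = b + q * of_int i"
  "drift_seq q [a, b] (2 * i + 2) = a + q * of_int i + q"
  using drift_seq_cell[of "[a, b]" 2 0 q i] drift_seq_cell[of "[a, b]" 2 1 q i] drift_seq_cell[of "[a, b]" 2 0 q "i + 1"]
  by (simp_all add: algebra_simps)

lemma drift_seq_4:
  "drift_seq q [a, b, d, e] (4 * i) = a + q * of_int i"
  "drift_seq q [a, b, d, e] (4 * i + 1) = b + q * of_int i"
  "drift_seq q [a, b, d, e] (4 * i + 2) = d + q * of_int i"
  "drift_seq q [a, b, d, e] (4 * i + 3) = e + q * of_int i"
  "drift_seq q [a, b, d, e] (4 * i + 4) = a + q * of_int i + q"
  using drift_seq_cell[of "[a, b, d, e]" 4 0 q i] drift_seq_cell[of "[a, b, d, e]" 4 1 q i]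
    drift_seq_cell[of "[a, b, d, e]" 4 2 q i] drift_seq_cell[of "[a, b, d, e]" 4 3 q i]
    drift_seq_cell[of "[a, b, d, e]" 4 0 q "i + 1"]
  by (simp_all add: algebra_simps)

lemma uni_curve_eq_staircase:
  "uni_curve a1 c n T = staircase_curve a1 c (drift_seq T [0, T]) (drift_seq T [- (n * T), - (n * T)])"
proof (rule ext)
  fix \<mu> :: real
  define i where "i = \<lfloor>\<mu> / 2\<rfloor>"
  have "of_int i \<le> \<mu> / 2" "\<mu> / 2 < of_int i + 1" unfolding i_def by linarith+
  then have i: "2 * of_int i \<le> \<mu>" "\<mu> < 2 * of_int i + 2" by auto
  note v = drift_seq_2
  show "uni_curve a1 c n T \<mu> = staircase_curve a1 c (drift_seq T [0, T]) (drift_seq T [- (n * T), - (n * T)]) \<mu>"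
  proof (cases "\<mu> \<le> 2 * of_int i + 1")
    case True
    with i show ?thesis
      by (simp add: uni_curve_1[of \<mu> i] staircase_curve_def interp_on_edge[of "2 * i" \<mu>] v)
        (simp add: algebra_simps)
  next
    case False
    with i show ?thesis
      by (simp add: uni_curve_2[of \<mu> i] staircase_curve_def interp_on_edge[of "2 * i + 1" \<mu>] v
          add.assoc) (simp add: algebra_simps)
  qed
qed

lemma bi_curve_eq_staircase:
  "bi_curve a1 c n T1 T2 \<theta> = staircase_curve a1 c
     (drift_seq (T1 + T2) [0, T1, T1, T1 + T2])
     (drift_seq (T1 + T2) [- (n * (T1 + T2)), - (n * (T1 + T2)),
        T2 + \<theta> * T1 - n * (T1 + T2), T2 + \<theta> * T1 - n * (T1 + T2)])"
  (is "_ = staircase_curve a1 c ?p ?w")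
proof (rule ext)
  fix \<mu> :: real
  define i where "i = \<lfloor>\<mu> / 4\<rfloor>"
  have "of_int i \<le> \<mu> / 4" "\<mu> / 4 < of_int i + 1" unfolding i_def by linarith+
  then have i: "4 * of_int i \<le> \<mu>" "\<mu> < 4 * of_int i + 4" by auto
  note v = drift_seq_4
  consider "\<mu> \<le> 4 * of_int i + 1" | "4 * of_int i + 1 \<le> \<mu>" "\<mu> \<le> 4 * of_int i + 2"
    | "4 * of_int i + 2 \<le> \<mu>" "\<mu> \<le> 4 * of_int i + 3" | "4 * of_int i + 3 \<le> \<mu>" by linarith
  then show "bi_curve a1 c n T1 T2 \<theta> \<mu> = staircase_curve a1 c ?p ?w \<mu>"
  proof cases
    case 1
    with i show ?thesis
      by (simp add: bi_curve_1[of \<mu> i "T1 + T2"] staircase_curve_def interp_on_edge[of "4 * i" \<mu>] v)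
  next
    case 2
    with i show ?thesis
      by (simp add: bi_curve_2[of \<mu> i "T1 + T2"] staircase_curve_def
          interp_on_edge[of "4 * i + 1" \<mu>] v add.assoc)
  next
    case 3
    with i show ?thesis
      by (simp add: bi_curve_3[of \<mu> i "T1 + T2"] staircase_curve_def
          interp_on_edge[of "4 * i + 2" \<mu>] v add.assoc) (simp add: algebra_simps)
  next
    case 4
    with i show ?thesis
      by (simp add: bi_curve_4[of \<mu> i "T1 + T2"] staircase_curve_def
          interp_on_edge[of "4 * i + 3" \<mu>] v add.assoc) (simp add: algebra_simps)
  qed
qed

lemma int_less_5_cases:
  fixes k :: int
  assumes "0 \<le> k" "k < 5"
  obtains "k = 0" | "k = 1" | "k = 2" | "k = 3" | "k = 4"
  using assms by linarith

text \<open>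
  One period takes five steps.  While \<open>\<mu>0\<close> climbs a slope, \<open>\<mu>1\<close> slides down a vertical edge so as
  to keep \<open>F = 0\<close>, and \<open>\<mu>2\<close> rests.  While \<open>\<mu>0\<close> falls, both delayed points climb slopes and
  \<open>F\<close> decreases; \<open>\<mu>0\<close> pauses once for \<open>\<mu>2\<close> to fall, which raises \<open>F\<close> but keeps it negative by the
  lower bound on \<open>\<theta>\<close>, and once more at the bottom for \<open>\<mu>1\<close> to fall until \<open>F = 0\<close> again.  The
  balance equation says that \<open>\<mu>1\<close> reaches the foot of its edge exactly when \<open>\<mu>0\<close> reaches the top.
\<close>

lemma unimodal_periodic_solution:
  fixes a1 a2 c T \<theta> K1 K2 :: real and m :: int and n :: nat
  assumes "0 < c" "0 < T" and \<theta>: "0 < \<theta>" "\<theta> < 1" and K1: "1 < K1"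
    and gap: "a2 - a1 = (of_int m + \<theta>) * T"
    and balance: "a1 * (1 + K1 + K2) = n * T * (1 + K1 + K2) + T + K2 * (1 - \<theta>) * T"
    and \<theta>_K: "K2 < (K1 + K2 - 1) * \<theta>" and "0 < K2"
  shows "\<exists>\<mu>0 \<mu>1 \<mu>2. periodic_singular_solution a1 a2 c K1 K2 (uni_curve a1 c n T) UNIV \<mu>0 \<mu>1 \<mu>2 T"
proof -
  define p w where "p = drift_seq T [0, T]" and "w = drift_seq T [- (n * T), - (n * T)]"
  \<comment> \<open>Slope and vertical edge of period \<open>j\<close>, parametrised by \<open>0 \<le> v \<le> 1\<close>.\<close>
  define A :: "int \<Rightarrow> real \<Rightarrow> real" where "A j v = 2 * of_int j + v" for j v
  define B :: "int \<Rightarrow> real \<Rightarrow> real" where "B j v = 2 * of_int j + 1 + v" for j v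
  note v = drift_seq_2
  have A: "interp p (A j v) = (of_int j + v) * T" "interp w (A j v) = (of_int j - n) * T"
    if "0 \<le> v" "v \<le> 1" for j :: int and v :: real
    using that interp_on_edge[of "2 * j" "A j v"]
    by (simp_all add: A_def p_def w_def v) (simp_all add: algebra_simps)
  have B: "interp p (B j v) = (of_int j + 1) * T" "interp w (B j v) = (of_int j - n + v) * T"
    if "0 \<le> v" "v \<le> 1" for j :: int and v :: real
    using that interp_on_edge[of "2 * j + 1" "B j v"]
    by (simp_all add: B_def p_def w_def v add.assoc) (simp_all add: algebra_simps)
  \<comment> \<open>The delayed times lag \<open>n\<close> and \<open>n + m\<close> whole periods behind, up to the remainder \<open>\<theta> T\<close>.\<close>
  define b1 b2 where "b1 = - int n" and "b2 = - int n - m"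
  \<comment> \<open>On a slope \<open>c K1 u(\<mu>1)\<close> must drop by \<open>T\<close>, so \<open>\<mu>1\<close> starts at relative height \<open>1 / K1\<close>.\<close>
  define r where "r = 1 - 1 / K1"
  have r1: "0 \<le> r" "r \<le> 1" "K1 * (T * r) = K1 * T - T"
    using K1 by (simp_all add: r_def field_simps)
  define x0 where "x0 = drift_seq 2 [A 0 0, A 0 1, B 0 \<theta>, B 0 \<theta>, B 0 1]"
  define x1 where "x1 = drift_seq 2 [B (b1 - 1) r, A b1 0, A b1 \<theta>, A b1 \<theta>, A b1 1]"
  define x2 where "x2 = drift_seq 2
    [A (b2 - 1) (1 - \<theta>), A (b2 - 1) (1 - \<theta>), A (b2 - 1) 1, A b2 0, A b2 (1 - \<theta>)]"
  have x0: "x0 0 = A 0 0" "x0 1 = A 0 1" "x0 2 = B 0 \<theta>" "x0 3 = B 0 \<theta>" "x0 4 = B 0 1"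
    "x0 5 = A 0 0 + 2"
    by (simp_all add: x0_def drift_seq_def)
  have x1: "x1 0 = B (b1 - 1) r" "x1 1 = A b1 0" "x1 2 = A b1 \<theta>" "x1 3 = A b1 \<theta>"
    "x1 4 = A b1 1" "x1 5 = B (b1 - 1) r + 2"
    by (simp_all add: x1_def drift_seq_def)
  have x2: "x2 0 = A (b2 - 1) (1 - \<theta>)" "x2 1 = A (b2 - 1) (1 - \<theta>)" "x2 2 = A (b2 - 1) 1"
    "x2 3 = A b2 0" "x2 4 = A b2 (1 - \<theta>)" "x2 5 = A (b2 - 1) (1 - \<theta>) + 2"
    by (simp_all add: x2_def drift_seq_def)
  have le: "0 \<le> \<theta>" "\<theta> \<le> 1" "0 \<le> 1 - \<theta>" "1 - \<theta> \<le> 1" using \<theta> by simp_all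
  note vals = x0 x1 x2 A[OF order_refl zero_le_one] A[OF zero_le_one order_refl]
    A[OF le(1,2)] A[OF le(3,4)] B[OF zero_le_one order_refl] B[OF le(1,2)] B[OF r1(1,2)]
  have edges: "\<exists>l. {y, z} \<subseteq> {of_int l .. of_int l + 1}"
    if "of_int l \<le> y" "y \<le> of_int l + 1" "of_int l \<le> z" "z \<le> of_int l + 1" for l :: int and y z :: real
    using that by (intro exI[of _ l]) simp
  interpret staircase_solution p w 2 T a1 c a2 K1 K2 5 "\<lambda>k. 5 dvd k" x0 x1 x2
    "\<lambda>k. - (interp p (x0 k) - a1 - interp w (x0 k))
        - K1 * (interp p (x1 k) - a1 - interp w (x1 k))
        - K2 * (interp p (x2 k) - a1 - interp w (x2 k))"
  proof (unfold_locales, goal_cases)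
    case (7 l)
    then obtain i where "l = 2 * i" by (elim evenE)
    then show ?case using \<open>0 < T\<close> by (simp add: p_def w_def v)
  next
    case (8 l)
    then obtain i where "l = 2 * i + 1" by (elim oddE)
    then show ?case using \<open>0 < T\<close> by (simp add: p_def w_def v add.assoc)
  next
    case (9 l)
    then obtain i where "l = 2 * i + 1" by (elim oddE)
    then show ?case by (simp add: p_def w_def v drift_seq_def[of _ _ 1])
  next
    case (16 k)
    then show ?case
    proof (cases rule: int_less_5_cases)
      case 1 then show ?thesis by (intro exI[of _ 0]) (simp add: x0 A_def)
    qed (rule exI[of _ 1]; simp add: x0 A_def B_def \<theta> less_imp_le)+
  next
    case (17 k)
    then show ?case
    proof (cases rule: int_less_5_cases)
      case 1 then show ?thesis using r1 by (intro edges[of "2 * b1 - 1"]) (simp_all add: x1 A_def B_def)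
    next
      case 5 then show ?thesis using r1 by (intro edges[of "2 * b1 + 1"]) (simp_all add: x1 A_def B_def)
    qed (rule edges[of "2 * b1"]; simp add: x1 A_def \<theta> less_imp_le)+
  next
    case (18 k)
    then show ?case
    proof (cases rule: int_less_5_cases)
      case 3 then show ?thesis by (intro edges[of "2 * b2 - 1"]) (simp_all add: x2 A_def)
    next
      case 4 then show ?thesis using \<theta> by (intro edges[of "2 * b2"]) (simp_all add: x2 A_def)
    next
      case 5 then show ?thesis using \<theta> by (intro edges[of "2 * b2"]) (simp_all add: x2 A_def)
    qed (rule edges[of "2 * b2 - 2"]; simp add: x2 A_def \<theta> less_imp_le)+
  next
    case (19 k)
    then show ?case
      by (cases rule: int_less_5_cases) (simp add: vals b1_def; simp add: algebra_simps)+
  next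
    case (20 k)
    then show ?case
      by (cases rule: int_less_5_cases) (simp add: vals b2_def gap; simp add: algebra_simps)+
  next
    case (22 k)
    from 22(1-3) have "k = 0" by (cases rule: int_less_5_cases) auto
    then show ?case using balance r1(3) by (simp add: vals) (simp add: algebra_simps)
  next
    case (23 k)
    have pos: "0 < (K1 + K2 - 1) * \<theta> * T" "K2 * T < (K1 + K2 - 1) * \<theta> * T" "0 < (K1 - 1) * T"
      using \<theta>_K \<theta> K1 \<open>0 < K2\<close> \<open>0 < T\<close> by simp_all
    from 23(1,2) show ?case
      by (cases rule: int_less_5_cases)
        (use 23(3,4) pos balance in \<open>(simp add: vals; simp add: algebra_simps)+\<close>)
  next
    case (12 k) show ?case by presburger
  next
    case (24 k) then show ?case by presburger
  qed (use \<open>0 < c\<close> \<open>0 < T\<close> in \<open>auto simp: p_def w_def x0_def x1_def x2_def drift_seq_shift\<close>)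
  from periodic show ?thesis
    unfolding p_def w_def uni_curve_eq_staircase[symmetric] by blast
qed

section \<open>The type I bimodal solution\<close>

lemma int_less_10_cases:
  fixes k :: int
  assumes "0 \<le> k" "k < 10"
  obtains "k = 0" | "k = 1" | "k = 2" | "k = 3" | "k = 4"
    | "k = 5" | "k = 6" | "k = 7" | "k = 8" | "k = 9"
proof -
  have "k = 0 \<or> k = 1 \<or> k = 2 \<or> k = 3 \<or> k = 4 \<or> k = 5 \<or> k = 6 \<or> k = 7 \<or> k = 8 \<or> k = 9"
    using assms by presburger
  with that show ?thesis by blast
qed

text \<open>
  One period takes ten steps.  On the long slope (step 0) \<open>\<mu>1\<close> slides down the second vertical edge to
  keep \<open>F = 0\<close>; on the short slope (step 5) \<open>\<mu>2\<close> does.  The two balance equations say that the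
  sliding point reaches the foot of its edge together with the end of the slope.  On the first drop
  \<open>\<mu>0\<close> pauses for \<open>\<mu>2\<close> to fall through the first vertical edge and then into the second; on the
  second drop it pauses for \<open>\<mu>1\<close> to do the same.  A fall through a whole first vertical edge raises
  \<open>F\<close>; \<open>jump2\<close> and \<open>jump1\<close> say that \<open>F\<close> is still negative after such a fall of \<open>\<mu>2\<close> and \<open>\<mu>1\<close>,
  respectively.  Here \<open>q = \<theta> T1\<close>.
\<close>

lemma bimodal_periodic_solution:
  fixes a1 a2 c T1 T2 q K1 K2 \<theta> :: real and m :: int and n :: nat
  assumes "0 < c" and T2: "0 < T2" and q: "0 < q" "q = \<theta> * T1"
    and K1: "1 < K1" and K2: "0 < K2" "K2 < 1"
    and fit: "T2 + q < T1" "T1 / K1 < T1 - q" "T2 / K2 < T1 - q"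
    and gap: "a2 - a1 = of_int m * (T1 + T2) + T2 + q"
    and balance1: "a1 * (1 + K1 + K2) = n * (T1 + T2) * (1 + K1 + K2) + T1 + K2 * (T1 - q)"
    and balance2: "a1 * (1 + K1 + K2) = n * (T1 + T2) * (1 + K1 + K2) + (T1 - q) + K1 * (q + T2)"
    and jump2: "K2 * T2 < (K1 - 1) * q"
    and jump1: "K1 * q + (K1 + K2 - 1) * T2 < (K1 - 1) * T1"
  shows "\<exists>\<mu>0 \<mu>1 \<mu>2. periodic_singular_solution a1 a2 c K1 K2
           (bi_curve a1 c n T1 T2 \<theta>) UNIV \<mu>0 \<mu>1 \<mu>2 (T1 + T2)"
proof -
  define T h where "T = T1 + T2" and "h = T1 - q"
  have T1: "0 < T1" using fit(1) T2 q(1) by linarith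
  have h: "0 < h" "T2 < h" "h < T1" using fit(1) T2 q(1) by (simp_all add: h_def)
  have T: "0 < T" using T1 T2 by (simp add: T_def)
  define p w where "p = drift_seq T [0, T1, T1, T]"
    and "w = drift_seq T [- (n * T), - (n * T), T2 + q - n * T, T2 + q - n * T]"
  \<comment> \<open>The four edges of period \<open>j\<close>, parametrised by the length \<open>v\<close> covered in \<open>t\<close> or \<open>w\<close>.\<close>
  define A :: "int \<Rightarrow> real \<Rightarrow> real" where "A j v = 4 * of_int j + v / T1" for j v
  define B :: "int \<Rightarrow> real \<Rightarrow> real" where "B j v = 4 * of_int j + 1 + v / (T2 + q)" for j v
  define C :: "int \<Rightarrow> real \<Rightarrow> real" where "C j v = 4 * of_int j + 2 + v / T2" for j v
  define D :: "int \<Rightarrow> real \<Rightarrow> real" where "D j v = 4 * of_int j + 3 + v / h" for j v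
  note v = drift_seq_4
  have A: "interp p (A j v) = of_int j * T + v" "interp w (A j v) = (of_int j - n) * T"
    "4 * of_int j \<le> A j v" "A j v \<le> 4 * of_int j + 1"
    if "0 \<le> v" "v \<le> T1" for j :: int and v :: real
  proof -
    show 1: "4 * of_int j \<le> A j v" "A j v \<le> 4 * of_int j + 1"
      using that T1 by (simp_all add: A_def)
    show "interp p (A j v) = of_int j * T + v" "interp w (A j v) = (of_int j - n) * T"
      using T1 1 interp_on_edge[of "4 * j" "A j v"]
      by (simp_all add: p_def w_def v) (simp_all add: A_def algebra_simps)
  qed
  have B: "interp p (B j v) = of_int j * T + T1" "interp w (B j v) = (of_int j - n) * T + v"
    "4 * of_int j + 1 \<le> B j v" "B j v \<le> 4 * of_int j + 2"
    if "0 \<le> v" "v \<le> T2 + q" for j :: int and v :: real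
  proof -
    have s: "0 < T2 + q" using T2 q(1) by simp
    then show 1: "4 * of_int j + 1 \<le> B j v" "B j v \<le> 4 * of_int j + 2"
      using that by (simp_all add: B_def)
    define s' where "s' = v / (T2 + q)"
    have "s' * (T2 + q) = v" "B j v = 4 * of_int j + 1 + s'" using s by (simp_all add: s'_def B_def)
    then show "interp p (B j v) = of_int j * T + T1" "interp w (B j v) = (of_int j - n) * T + v"
      using 1 interp_on_edge[of "4 * j + 1" "B j v"]
      by (simp_all add: p_def w_def v add.assoc) (simp_all add: algebra_simps)
  qed
  have C: "interp p (C j v) = of_int j * T + T1 + v" "interp w (C j v) = (of_int j - n) * T + T2 + q"
    "4 * of_int j + 2 \<le> C j v" "C j v \<le> 4 * of_int j + 3"
    if "0 \<le> v" "v \<le> T2" for j :: int and v :: real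
  proof -
    show 1: "4 * of_int j + 2 \<le> C j v" "C j v \<le> 4 * of_int j + 3"
      using that T2 by (simp_all add: C_def)
    define s' where "s' = v / T2"
    have "s' * T2 = v" "C j v = 4 * of_int j + 2 + s'" using T2 by (simp_all add: s'_def C_def)
    then show "interp p (C j v) = of_int j * T + T1 + v" "interp w (C j v) = (of_int j - n) * T + T2 + q"
      using 1 interp_on_edge[of "4 * j + 2" "C j v"]
      by (simp_all add: p_def w_def v add.assoc) (simp_all add: T_def algebra_simps)
  qed
  have D: "interp p (D j v) = (of_int j + 1) * T" "interp w (D j v) = (of_int j - n) * T + T2 + q + v"
    "4 * of_int j + 3 \<le> D j v" "D j v \<le> 4 * of_int j + 4"
    if "0 \<le> v" "v \<le> h" for j :: int and v :: real
  proof -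
    show 1: "4 * of_int j + 3 \<le> D j v" "D j v \<le> 4 * of_int j + 4"
      using that h by (simp_all add: D_def)
    define s' where "s' = v / h"
    have "s' * h = v" "D j v = 4 * of_int j + 3 + s'" using h by (simp_all add: s'_def D_def)
    then show "interp p (D j v) = (of_int j + 1) * T" "interp w (D j v) = (of_int j - n) * T + T2 + q + v"
      using 1 interp_on_edge[of "4 * j + 3" "D j v"]
      by (simp_all add: p_def w_def v add.assoc) (simp_all add: T_def h_def algebra_simps)
  qed
  define b1 b2 where "b1 = - int n" and "b2 = - int n - m"
  \<comment> \<open>Starting points of the two slides: heights \<open>T1 / K1\<close> and \<open>T2 / K2\<close> above the foot balance the rise of \<open>\<mu>0\<close>.\<close>
  define r1 r2 where "r1 = h - T1 / K1" and "r2 = h - T2 / K2"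
  have r: "0 \<le> r1" "r1 \<le> h" "0 \<le> r2" "r2 \<le> h" "K1 * r1 = K1 * h - T1" "K2 * r2 = K2 * h - T2"
    using fit T1 T2 K1 K2 by (simp_all add: r1_def r2_def h_def algebra_simps)
  define x0 where "x0 = drift_seq 4
    [A 0 0, A 0 T1, B 0 q, B 0 q, C 0 0, C 0 0, D 0 0, D 0 (h - T2), D 0 (h - T2), D 0 h]"
  define x1 where "x1 = drift_seq 4
    [D (b1 - 1) r1, A b1 0, A b1 q, A b1 q, A b1 (T2 + q), A b1 (T2 + q), A b1 (T2 + q),
     A b1 T1, B b1 (T2 + q), C b1 T2]"
  define x2 where "x2 = drift_seq 4
    [A (b2 - 1) h, A (b2 - 1) h, A (b2 - 1) T1, B (b2 - 1) (T2 + q), C (b2 - 1) T2,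
     D (b2 - 1) r2, A b2 0, A b2 (h - T2), A b2 (h - T2), A b2 h]"
  have x0: "x0 0 = A 0 0" "x0 1 = A 0 T1" "x0 2 = B 0 q" "x0 3 = B 0 q" "x0 4 = C 0 0" "x0 5 = C 0 0"
    "x0 6 = D 0 0" "x0 7 = D 0 (h - T2)" "x0 8 = D 0 (h - T2)" "x0 9 = D 0 h" "x0 10 = A 0 0 + 4"
    by (simp_all add: x0_def drift_seq_def)
  have x1: "x1 0 = D (b1 - 1) r1" "x1 1 = A b1 0" "x1 2 = A b1 q" "x1 3 = A b1 q"
    "x1 4 = A b1 (T2 + q)" "x1 5 = A b1 (T2 + q)" "x1 6 = A b1 (T2 + q)" "x1 7 = A b1 T1"
    "x1 8 = B b1 (T2 + q)" "x1 9 = C b1 T2" "x1 10 = D b1 r1"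
    by (simp_all add: x1_def drift_seq_def D_def)
  have x2: "x2 0 = A (b2 - 1) h" "x2 1 = A (b2 - 1) h" "x2 2 = A (b2 - 1) T1"
    "x2 3 = B (b2 - 1) (T2 + q)" "x2 4 = C (b2 - 1) T2" "x2 5 = D (b2 - 1) r2" "x2 6 = A b2 0"
    "x2 7 = A b2 (h - T2)" "x2 8 = A b2 (h - T2)" "x2 9 = A b2 h" "x2 10 = A b2 h"
    by (simp_all add: x2_def drift_seq_def A_def)
  have le: "0 \<le> T1" "0 \<le> q" "q \<le> T1" "0 \<le> T2 + q" "T2 + q \<le> T1" "0 \<le> h" "h \<le> T1"
    "0 \<le> h - T2" "h - T2 \<le> T1" "q \<le> T2 + q" "0 \<le> T2" "h - T2 \<le> h"
    using T1 T2 q(1) h fit by simp_all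
  note As = A[OF order_refl le(1)] A[OF le(1) order_refl] A[OF le(2,3)] A[OF le(4,5)] A[OF le(6,7)]
    A[OF le(8,9)]
  note Bs = B[OF le(2,10)] B[OF le(4) order_refl]
  note Cs = C[OF order_refl le(11)] C[OF le(11) order_refl]
  note Ds = D[OF order_refl le(6)] D[OF le(8,12)] D[OF le(6) order_refl] D[OF r(1,2)] D[OF r(3,4)]
  note vals = x0 x1 x2 As Bs Cs Ds
  have ends: "A j 0 = 4 * of_int j" "A j T1 = 4 * of_int j + 1" "B j (T2 + q) = 4 * of_int j + 2"
    "C j 0 = 4 * of_int j + 2" "C j T2 = 4 * of_int j + 3" "D j 0 = 4 * of_int j + 3" for j
    using T1 T2 q(1) by (simp_all add: A_def B_def C_def D_def)
  have B0: "1 \<le> B 0 q" "B 0 q \<le> 2" using Bs[of 0] by simp_all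
  have grow: "D 0 h = 4" "D 0 (h - T2) \<le> 4"
    using h T2 by (simp_all add: D_def)
  have edges: "\<exists>l. {y, z} \<subseteq> {of_int l .. of_int l + 1}"
    if "of_int l \<le> y" "y \<le> of_int l + 1" "of_int l \<le> z" "z \<le> of_int l + 1" for l :: int and y z :: real
    using that by (intro exI[of _ l]) simp
  define F where "F k = - (interp p (x0 k) - a1 - interp w (x0 k))
        - K1 * (interp p (x1 k) - a1 - interp w (x1 k))
        - K2 * (interp p (x2 k) - a1 - interp w (x2 k))" for k
  have F_slope: "F 0 = 0" "F 1 = 0" "F 5 = 0" "F 6 = 0"
    using balance1 balance2 r(5,6)
    by (simp_all add: F_def vals) (simp_all add: T_def h_def algebra_simps)
  have F_drop: "F 2 = - ((K1 + K2 - 1) * q)" "F 3 = K2 * T2 - (K1 - 1) * q"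
    "F 4 = - ((K1 - 1) * (T2 + q))" "F 7 = - ((K1 - 1) * T1) - (1 - K2) * T2"
    "F 8 = K1 * q + (K1 + K2 - 1) * T2 - (K1 - 1) * T1" "F 9 = K1 * q - (K1 - 1) * T1"
    using balance1
    by (simp_all add: F_def vals) (simp_all add: T_def h_def algebra_simps)
  have "0 < (K1 + K2 - 1) * q" "0 < (K1 - 1) * (T2 + q)" "0 < (K1 - 1) * T1" "0 < (1 - K2) * T2"
    "0 < (K1 + K2 - 1) * T2"
    using K1 K2 T1 T2 q(1) by simp_all
  then have F_neg: "F 2 < 0" "F 3 < 0" "F 4 < 0" "F 7 < 0" "F 8 < 0" "F 9 < 0"
    unfolding F_drop using jump1 jump2 by linarith+
  interpret staircase_solution p w 4 T a1 c a2 K1 K2 10 "\<lambda>k. 5 dvd k" x0 x1 x2 F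
  proof (unfold_locales, goal_cases)
    case (7 l)
    then obtain i where "l = 2 * i" by (elim evenE)
    moreover have "\<exists>j. i = 2 * j \<or> i = 2 * j + 1" by presburger
    then obtain j where "i = 2 * j \<or> i = 2 * j + 1" ..
    ultimately have "l = 4 * j \<or> l = 4 * j + 2" by auto
    then show ?case
      using T1 T2 by (auto simp: p_def w_def v add.assoc) (simp_all add: T_def)
  next
    case (8 l)
    then obtain i where "l = 2 * i + 1" by (elim oddE)
    moreover have "\<exists>j. i = 2 * j \<or> i = 2 * j + 1" by presburger
    then obtain j where "i = 2 * j \<or> i = 2 * j + 1" ..
    ultimately have "l = 4 * j + 1 \<or> l = 4 * j + 3" by auto
    then show ?case
      using T1 T2 q(1) h by (auto simp: p_def w_def v add.assoc) (simp_all add: T_def h_def)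
  next
    case (9 l)
    then obtain i where "l = 2 * i + 1" by (elim oddE)
    moreover have "\<exists>j. i = 2 * j \<or> i = 2 * j + 1" by presburger
    then obtain j where "i = 2 * j \<or> i = 2 * j + 1" ..
    ultimately have "l = 4 * j + 1 \<or> l = 4 * j + 3" by auto
    then show ?case
      using q by (auto simp: p_def w_def v drift_seq_def[of _ _ 1]) (simp add: T_def)
  next
    case (10 l)
    from 10(1) obtain i where "l = 2 * i + 1" by (elim oddE)
    moreover have "\<exists>j. i = 2 * j \<or> i = 2 * j + 1" by presburger
    then obtain j where "i = 2 * j \<or> i = 2 * j + 1" ..
    ultimately have "l = 4 * j + 1 \<or> l = 4 * j + 3" by auto
    then show ?case
    proof
      assume "l = 4 * j + 3"
      with 10(2) q(1) have False
        by (simp add: p_def w_def v drift_seq_def[of _ _ 1]) (simp add: T_def)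
      then show ?case ..
    qed simp
  next
    case (16 k)
    then show ?case
    proof (cases rule: int_less_10_cases)
      case 1 then show ?thesis by (intro exI[of _ 0]) (simp add: x0 ends)
    next
      case 6 then show ?thesis by (intro exI[of _ 2]) (simp add: x0 ends)
    next
      case 7 then show ?thesis using Ds[of 0] by (intro exI[of _ 3]) (simp add: x0 ends)
    next
      case 8 then show ?thesis using Ds[of 0] by (intro exI[of _ 3]) (simp add: x0 ends)
    next
      case 9 then show ?thesis using Ds[of 0] grow by (intro exI[of _ 3]) (simp add: x0 ends)
    next
      case 10 then show ?thesis using Ds[of 0] grow by (intro exI[of _ 3]) (simp add: x0 ends)
    qed (rule exI[of _ 1]; simp add: x0 ends B0)+
  next
    case (17 k)
    then show ?case
    proof (cases rule: int_less_10_cases)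
      case 1 then show ?thesis using Ds[of "b1 - 1"]
        by (intro edges[of "4 * b1 - 1"]) (simp_all add: x1 ends)
    next
      case 8 then show ?thesis by (intro edges[of "4 * b1 + 1"]) (simp_all add: x1 ends)
    next
      case 9 then show ?thesis by (intro edges[of "4 * b1 + 2"]) (simp_all add: x1 ends)
    next
      case 10 then show ?thesis using Ds[of b1]
        by (intro edges[of "4 * b1 + 3"]) (simp_all add: x1 ends)
    qed (rule edges[of "4 * b1"]; simp add: x1 ends As)+
  next
    case (18 k)
    then show ?case
    proof (cases rule: int_less_10_cases)
      case 1 then show ?thesis using As[of "b2 - 1"]
        by (intro edges[of "4 * b2 - 4"]) (simp_all add: x2 ends)
    next
      case 2 then show ?thesis using As[of "b2 - 1"]
        by (intro edges[of "4 * b2 - 4"]) (simp_all add: x2 ends)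
    next
      case 3 then show ?thesis by (intro edges[of "4 * b2 - 3"]) (simp_all add: x2 ends)
    next
      case 4 then show ?thesis by (intro edges[of "4 * b2 - 2"]) (simp_all add: x2 ends)
    next
      case 5 then show ?thesis using Ds[of "b2 - 1"]
        by (intro edges[of "4 * b2 - 1"]) (simp_all add: x2 ends)
    next
      case 6 then show ?thesis using Ds[of "b2 - 1"]
        by (intro edges[of "4 * b2 - 1"]) (simp_all add: x2 ends)
    qed (rule edges[of "4 * b2"]; simp add: x2 ends As)+
  next
    case (19 k)
    then show ?case
      by (cases rule: int_less_10_cases)
        (simp add: vals b1_def; simp add: T_def h_def algebra_simps)+
  next
    case (20 k)
    then show ?case
      by (cases rule: int_less_10_cases)
        (simp add: vals b2_def gap; simp add: T_def h_def algebra_simps)+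
  next
    case (22 k)
    from 22(1-3) have "k = 0 \<or> k = 5" by (cases rule: int_less_10_cases) auto
    then show ?case by (auto simp: F_slope)
  next
    case (23 k)
    from 23(1,2) show ?case
      by (cases rule: int_less_10_cases) (use 23(3,4) F_neg in simp_all)
  next
    case (12 k) show ?case by presburger
  next
    case (24 k) then show ?case by presburger
  qed (use \<open>0 < c\<close> T in \<open>auto simp: p_def w_def x0_def x1_def x2_def drift_seq_shift F_def\<close>)
  from periodic show ?thesis
    unfolding p_def w_def T_def q(2) bi_curve_eq_staircase[symmetric] by blast
qed

section \<open>Limiting profiles\<close>

lemma int_mod_4_cases:
  fixes k :: int
  obtains i where "k = 4 * i" | i where "k = 4 * i + 1" | i where "k = 4 * i + 2" | i where "k = 4 * i + 3"
proof -
  have "\<exists>i. k = 4 * i \<or> k = 4 * i + 1 \<or> k = 4 * i + 2 \<or> k = 4 * i + 3" by presburger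
  with that show ?thesis by blast
qed

text \<open>
  For \<open>T2 = 0\<close> the short slope shrinks to a point and the two vertical edges join, so the curve is the
  unimodal one run through at a different speed; \<open>\<phi>\<close> is this change of parameter, resting at
  \<open>2 i + 1 + \<theta>\<close> during the lost slope.
\<close>

lemma range_bi_curve_degenerate:
  fixes T \<theta> :: real
  assumes "0 \<le> \<theta>" "\<theta> \<le> 1"
  shows "range (bi_curve a1 c n T 0 \<theta>) = range (uni_curve a1 c n T)"
proof -
  define \<phi> where "\<phi> = drift_seq 2 [0, 1, 1 + \<theta>, 1 + \<theta>]"
  define p w where "p = drift_seq T [0, T]" and "w = drift_seq T [- (n * T), - (n * T)]"
  have \<phi>: "\<phi> (4 * i) = 2 * of_int i" "\<phi> (4 * i + 1) = 2 * of_int i + 1"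
    "\<phi> (4 * i + 2) = 2 * of_int i + 1 + \<theta>" "\<phi> (4 * i + 3) = 2 * of_int i + 1 + \<theta>"
    "\<phi> (4 * i + 4) = 2 * of_int i + 2" for i
    by (simp_all add: \<phi>_def drift_seq_4)
  have edge: "\<exists>l. of_int l \<le> \<phi> k \<and> \<phi> k \<le> of_int l + 1 \<and> of_int l \<le> \<phi> (k + 1) \<and> \<phi> (k + 1) \<le> of_int l + 1" for k
  proof (cases k rule: int_mod_4_cases)
    case (1 i) then show ?thesis by (intro exI[of _ "2 * i"]) (simp add: \<phi> add.assoc)
  next
    case (2 i) then show ?thesis using assms by (intro exI[of _ "2 * i + 1"]) (simp add: \<phi> add.assoc)
  next
    case (3 i) then show ?thesis using assms by (intro exI[of _ "2 * i + 1"]) (simp add: \<phi> add.assoc)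
  next
    case (4 i) then show ?thesis using assms by (intro exI[of _ "2 * i + 1"]) (simp add: \<phi> add.assoc)
  qed
  have bend: "interp y (2 * of_int i + 1 + \<theta>) = (1 - \<theta>) * y (2 * i + 1) + \<theta> * y (2 * i + 2)" for y i
    using interp_on_edge[of "2 * i + 1" "2 * of_int i + 1 + \<theta>" y] assms by (simp add: algebra_simps)
  have straight: "interp y (2 * of_int i) = y (2 * i)" "interp y (2 * of_int i + 1) = y (2 * i + 1)" for y i
    using interp_of_int[of y "2 * i"] interp_of_int[of y "2 * i + 1"] by simp_all
  have p: "drift_seq (T + 0) [0, T, T, T + 0] = (\<lambda>k. interp p (\<phi> k))"
  proof
    show "drift_seq (T + 0) [0, T, T, T + 0] k = interp p (\<phi> k)" for k
      by (cases k rule: int_mod_4_cases)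
        (simp_all add: \<phi> bend straight drift_seq_4 p_def drift_seq_2, simp_all add: algebra_simps)
  qed
  have w: "drift_seq (T + 0) [- (n * (T + 0)), - (n * (T + 0)), 0 + \<theta> * T - n * (T + 0), 0 + \<theta> * T - n * (T + 0)]
      = (\<lambda>k. interp w (\<phi> k))"
  proof
    show "drift_seq (T + 0) [- (n * (T + 0)), - (n * (T + 0)), 0 + \<theta> * T - n * (T + 0), 0 + \<theta> * T - n * (T + 0)] k
      = interp w (\<phi> k)" for k
      by (cases k rule: int_mod_4_cases)
        (simp_all add: \<phi> bend straight drift_seq_4 w_def drift_seq_2, simp_all add: algebra_simps)
  qed
  have "bi_curve a1 c n T 0 \<theta> = uni_curve a1 c n T \<circ> interp \<phi>"
    unfolding bi_curve_eq_staircase uni_curve_eq_staircase p w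
    by (rule ext) (simp add: staircase_curve_def interp_interp edge p_def w_def)
  moreover have "surj (interp \<phi>)"
    by (rule surj_interp[where P = 4 and q = 2]) (simp_all add: \<phi>_def drift_seq_shift)
  ultimately show ?thesis by (metis image_comp)
qed

lemma tendsto_drift_seq:
  assumes "(q \<longlongrightarrow> q0) F" and "ys \<noteq> []" and "\<And>K. length (xs K) = length ys"
    and "\<And>i. i < length ys \<Longrightarrow> ((\<lambda>K. xs K ! i) \<longlongrightarrow> ys ! i) F"
  shows "((\<lambda>K. drift_seq (q K) (xs K) k) \<longlongrightarrow> drift_seq q0 ys k) F"
proof -
  have "nat (k mod int (length ys)) < length ys"
    using \<open>ys \<noteq> []\<close> by (simp add: nat_less_iff)
  then show ?thesis unfolding drift_seq_def assms(3) by (intro tendsto_intros assms)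
qed

lemma limiting_profile_staircase:
  assumes "\<And>k. ((\<lambda>K. p K k) \<longlongrightarrow> p0 k) F" "\<And>k. ((\<lambda>K. w K k) \<longlongrightarrow> w0 k) F"
  shows "limiting_profile (\<lambda>K. staircase_curve a1 c (p K) (w K)) F (staircase_curve a1 c p0 w0)"
  unfolding limiting_profile_def
proof (intro allI impI)
  fix S :: "real set" assume S: "compact S"
  have t: "uniform_limit S (\<lambda>K. interp (p K)) (interp p0) F"
    by (rule uniform_limit_interp[OF assms(1) S])
  have "uniform_limit S (\<lambda>K. interp (\<lambda>k. 1 / c * (p K k - a1 - w K k)))
      (interp (\<lambda>k. 1 / c * (p0 k - a1 - w0 k))) F"
    by (intro uniform_limit_interp[OF _ S] tendsto_intros assms)
  then have u: "uniform_limit S (\<lambda>K x. (interp (p K) x - a1 - interp (w K) x) / c)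
      (\<lambda>x. (interp p0 x - a1 - interp w0 x) / c) F"
    unfolding interp_cmult interp_diff interp_const by simp
  show "uniform_limit S (\<lambda>K. staircase_curve a1 c (p K) (w K)) (staircase_curve a1 c p0 w0) F"
  proof (rule uniform_limitI)
    fix e :: real assume "e > 0"
    then have "e / 2 > 0" by simp
    from uniform_limitD[OF t this] uniform_limitD[OF u this]
    show "\<forall>\<^sub>F K in F. \<forall>x\<in>S. dist (staircase_curve a1 c (p K) (w K) x) (staircase_curve a1 c p0 w0 x) < e"
    proof eventually_elim
      case (elim K)
      show ?case
      proof
        fix x assume "x \<in> S"
        have "dist (staircase_curve a1 c (p K) (w K) x) (staircase_curve a1 c p0 w0 x)
          \<le> dist (interp (p K) x) (interp p0 x)
            + dist ((interp (p K) x - a1 - interp (w K) x) / c) ((interp p0 x - a1 - interp w0 x) / c)"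
          unfolding staircase_curve_def dist_Pair_Pair by (rule sqrt_sum_squares_le_sum) simp_all
        also have "\<dots> < e / 2 + e / 2" using elim \<open>x \<in> S\<close> by (intro add_strict_mono) auto
        finally show "dist (staircase_curve a1 c (p K) (w K) x) (staircase_curve a1 c p0 w0 x) < e" by simp
      qed
    qed
  qed
qed

lemma limiting_profile_uni_curve:
  assumes "(T \<longlongrightarrow> T0) F"
  shows "limiting_profile (\<lambda>K. uni_curve a1 c n (T K)) F (uni_curve a1 c n T0)"
  unfolding uni_curve_eq_staircase
  by (intro limiting_profile_staircase tendsto_drift_seq assms)
    (auto simp: less_Suc_eq intro!: tendsto_intros assms)

lemma limiting_profile_bi_curve:
  assumes "(T1 \<longlongrightarrow> T10) F" "(T2 \<longlongrightarrow> T20) F" "(\<theta> \<longlongrightarrow> \<theta>0) F"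
  shows "limiting_profile (\<lambda>K. bi_curve a1 c n (T1 K) (T2 K) (\<theta> K)) F (bi_curve a1 c n T10 T20 \<theta>0)"
  unfolding bi_curve_eq_staircase
  by (intro limiting_profile_staircase tendsto_drift_seq assms tendsto_add)
    (auto simp: less_Suc_eq intro!: tendsto_intros assms)

section \<open>The critical value of \<open>K1\<close>\<close>

lemma largest_root_of_quadratic:
  fixes \<alpha> \<beta> \<gamma> x :: real
  assumes "0 < \<alpha>" and f: "\<And>K. f K = \<alpha> * K\<^sup>2 + \<beta> * K + \<gamma>" and "f x < 0"
  defines "M \<equiv> Max {K. f K = 0}"
  shows "f M = 0" and "\<And>y. f y < 0 \<Longrightarrow> y < M" and "\<And>y. x \<le> y \<Longrightarrow> y < M \<Longrightarrow> f y < 0"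
proof -
  define d where "d = sqrt (\<beta>\<^sup>2 - 4 * \<alpha> * \<gamma>)"
  have "4 * \<alpha> * f x = (2 * \<alpha> * x + \<beta>)\<^sup>2 - (\<beta>\<^sup>2 - 4 * \<alpha> * \<gamma>)"
    unfolding f by (simp add: power2_eq_square algebra_simps)
  moreover have "4 * \<alpha> * f x < 0" using assms(1,3) by (simp add: mult_pos_neg)
  ultimately have "0 < \<beta>\<^sup>2 - 4 * \<alpha> * \<gamma>" using zero_le_power2[of "2 * \<alpha> * x + \<beta>"] by linarith
  then have d: "0 < d" "d\<^sup>2 = \<beta>\<^sup>2 - 4 * \<alpha> * \<gamma>" by (simp_all add: d_def)
  define r s where "r = (- \<beta> - d) / (2 * \<alpha>)" and "s = (- \<beta> + d) / (2 * \<alpha>)"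
  have rs: "r < s" using d \<open>0 < \<alpha>\<close> by (simp add: r_def s_def divide_strict_right_mono)
  have sum: "\<alpha> * (r + s) = - \<beta>" using \<open>0 < \<alpha>\<close> by (simp add: r_def s_def field_simps)
  have "4 * \<alpha> * (\<alpha> * (r * s)) = (2 * \<alpha> * r) * (2 * \<alpha> * s)" by (simp add: algebra_simps)
  also have "\<dots> = (- \<beta> - d) * (- \<beta> + d)" using \<open>0 < \<alpha>\<close> by (simp add: r_def s_def)
  also have "\<dots> = \<beta>\<^sup>2 - d\<^sup>2" by (simp add: power2_eq_square algebra_simps)
  finally have prod: "\<alpha> * (r * s) = \<gamma>" using d(2) \<open>0 < \<alpha>\<close> by simp
  have fac: "f K = \<alpha> * ((K - r) * (K - s))" for K
  proof -
    have "\<alpha> * ((K - r) * (K - s)) = \<alpha> * K\<^sup>2 - \<alpha> * (r + s) * K + \<alpha> * (r * s)"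
      by (simp add: power2_eq_square algebra_simps)
    then show ?thesis unfolding sum prod f by simp
  qed
  have "{K. f K = 0} = {r, s}" using \<open>0 < \<alpha>\<close> by (auto simp: fac)
  then have M: "M = s" using rs by (simp add: M_def)
  have neg: "f y < 0 \<longleftrightarrow> r < y \<and> y < s" for y
    using \<open>0 < \<alpha>\<close> rs by (auto simp: fac mult_less_0_iff)
  show "f M = 0" by (simp add: M fac)
  show "f y < 0 \<Longrightarrow> y < M" for y by (simp add: M neg)
  show "x \<le> y \<Longrightarrow> y < M \<Longrightarrow> f y < 0" for y using \<open>f x < 0\<close> by (simp add: M neg)
qed

locale critical_regime =
  fixes a1 a2 c K2 M :: real and n :: nat and m :: int
  assumes a1: "0 < a1" and a2: "a1 < a2" and c: "0 < c" and K2: "0 < K2" "K2 < 1"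
    and m_lower: "of_nat n * (a2 / a1 - 1) < of_int m"
    and m_upper: "of_int m < m_dagger (a2 / a1) K2 n"
    and M_eq: "M = M_plus (a2 / a1) K2 n m"
begin

text \<open>
  In terms of \<open>b = A - 1\<close> and the excess \<open>p = m - n b\<close> the integers \<open>n\<close> and \<open>m\<close> disappear from \<open>G\<close>.
\<close>

definition b where "b = a2 / a1 - 1"
definition p where "p = of_int m - of_nat n * b"
definition "G K = G_poly (a2 / a1) K2 n m K"
definition "S K = 1 + K + K2"
definition "uni_denom K = 1 + (of_int m + 1) * K2 + of_nat n * S K"

lemma b_pos: "0 < b" using a1 a2 by (simp add: b_def)

lemma gap_eq: "a2 - a1 = a1 * b" using a1 by (simp add: b_def field_simps)

lemma p_pos: "0 < p" using m_lower by (simp add: p_def b_def)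

lemma m_eq: "of_int m = p + of_nat n * b" by (simp add: p_def)

lemma m_pos: "0 < (of_int m :: real)"
  unfolding m_eq using p_pos b_pos by (simp add: add_pos_nonneg)

text \<open>
  The two terms of the minimum in \<open>m_dagger\<close>.
\<close>

lemma b_lower: "1 + p * (2 + K2) < b" "p * (3 + K2) < b"
proof -
  have up: "p < (b - 2 - K2) / (2 + K2) + min ((1 + K2) / (2 + K2)) (1 - b / ((2 + K2) * (3 + K2)))"
    using m_upper by (simp add: m_dagger_def m_star_def p_def b_def diff_diff_eq)
  then have "p < (b - 2 - K2) / (2 + K2) + (1 + K2) / (2 + K2)" by simp
  also have "\<dots> = (b - 1) / (2 + K2)" by (simp add: add_divide_distrib[symmetric])
  finally show "1 + p * (2 + K2) < b" using K2 by (simp add: field_simps)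
  from up have "p < (b - 2 - K2) / (2 + K2) + (1 - b / ((2 + K2) * (3 + K2)))" by simp
  also have "\<dots> = b / (3 + K2)" using K2 by (simp add: divide_simps) (simp add: algebra_simps)
  finally show "p * (3 + K2) < b" using K2 by (simp add: field_simps)
qed

lemma G_eq: "G K = p * ((K + K2)\<^sup>2 - 1) - K * (b * (1 + K2) - K2) + K2 * (1 + K2) + b"
  by (simp add: G_def G_poly_def p_def b_def)

lemma G_eq_S: "G K = p * (S K * (S K - 2)) - b * (K * (1 + K2) - 1) + K2 * S K"
  by (simp add: G_eq S_def power2_eq_square algebra_simps)

text \<open>
  At \<open>1 + 1 / p\<close>, where the denominator of the bimodal period changes sign if \<open>n = 0\<close>, the polynomial
  factors, and its sign is decided by the first lower bound on \<open>b\<close>.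
\<close>

lemma G_at_1_plus_inverse_p: "G (1 + 1 / p) < 0"
proof -
  have "p * p * G (1 + 1 / p) = p * ((1 + 2 * p + p * K2 - b) * (1 + K2 + p * K2))"
    using p_pos by (simp add: G_eq power2_eq_square field_simps)
  also have "\<dots> < 0"
    using b_lower(1) K2 p_pos by (intro mult_pos_neg mult_neg_pos) (simp_all add: algebra_simps add_pos_pos)
  finally show ?thesis using p_pos by (simp add: mult_less_0_iff)
qed

lemma G_quadratic:
  "G K = p * K\<^sup>2 + (2 * p * K2 - (b * (1 + K2) - K2)) * K + (p * (K2\<^sup>2 - 1) + K2 * (1 + K2) + b)"
  by (simp add: G_eq power2_eq_square algebra_simps)

lemma G_M: "G M = 0"
  and G_neg_imp_less: "G K < 0 \<Longrightarrow> K < M"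
  and G_neg: "1 + 1 / p \<le> K \<Longrightarrow> K < M \<Longrightarrow> G K < 0"
proof -
  have M: "M = Max {K. G K = 0}" by (simp add: M_eq M_plus_def G_def)
  note root = largest_root_of_quadratic[where f = G, OF p_pos G_quadratic G_at_1_plus_inverse_p, folded M]
  show "G M = 0" "G K < 0 \<Longrightarrow> K < M" "1 + 1 / p \<le> K \<Longrightarrow> K < M \<Longrightarrow> G K < 0"
    by (fact root)+
qed

lemma M_gt: "1 + 1 / p < M" using G_neg_imp_less G_at_1_plus_inverse_p .

lemma M_gt_1: "1 < M" using M_gt p_pos by (smt (verit) zero_less_divide_1_iff)

text \<open>
  This is what puts \<open>\<theta>0\<close> below \<open>1 - 1 / M\<close>.  The second lower bound on \<open>b\<close> enters only for \<open>p > 1\<close>,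
  where \<open>1 + 1 / p < M\<close> no longer gives \<open>2 < M\<close>.
\<close>

lemma M_separation: "K2 < (M - 1)\<^sup>2"
proof -
  have "2 < M"
  proof (cases "p \<le> 1")
    case True
    then have "1 \<le> 1 / p" using p_pos by simp
    with M_gt show ?thesis by simp
  next
    case False
    then have "3 + K2 < p * (3 + K2)" using K2 by simp
    with b_lower(2) have b3: "3 + K2 < b" by linarith
    have "G 2 = (1 + K2) * (p * (3 + K2) - b) + K2 * (3 + K2 - b)"
      by (simp add: G_eq power2_eq_square algebra_simps)
    also have "\<dots> < 0" using b3 b_lower(2) K2 by (intro add_neg_neg mult_pos_neg) simp_all
    finally show ?thesis by (rule G_neg_imp_less)
  qed
  then have "1 < (M - 1)\<^sup>2" by (simp add: one_less_power)
  with K2 show ?thesis by simp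
qed

text \<open>
  Negativity of the denominator turns \<open>T2 > 0\<close> into \<open>G < 0\<close>.
\<close>

lemma bi_denom_neg:
  assumes "1 + 1 / p < K"
  shows "bi_denom K2 n m K < 0"
proof -
  have y: "1 < p * (K - 1)" using assms p_pos by (simp add: field_simps)
  have K1: "0 < K - 1" using assms p_pos by (smt (verit) zero_less_divide_1_iff)
  have "(2 + K2) * 1 \<le> (2 + K2) * (p * (K - 1))" using y K2 by (intro mult_left_mono) simp_all
  moreover have "(p * (2 + K2)) * (K - 1) \<le> (b - 1) * (K - 1)"
    using b_lower(1) K1 by (intro mult_right_mono) simp_all
  ultimately have "S K \<le> b * (K - 1)" by (simp add: S_def algebra_simps)
  then have "of_nat n * S K \<le> of_nat n * (b * (K - 1))" by (intro mult_left_mono) simp_all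
  moreover have "bi_denom K2 n m K = 1 - p * (K - 1) + (of_nat n * S K - of_nat n * (b * (K - 1)))"
    by (simp add: bi_denom_def m_eq S_def algebra_simps)
  ultimately show ?thesis using y by linarith
qed

lemma uni_denom_pos: "0 < K \<Longrightarrow> 0 < uni_denom K"
  using m_pos K2 by (simp add: uni_denom_def S_def add_pos_nonneg)

lemma uni_T_eq: "uni_T a1 a2 K2 n m K = a1 * (S K + b * K2) / uni_denom K"
  by (simp add: uni_T_def gap_eq uni_denom_def S_def algebra_simps)

lemma uni_T_uni_denom: "0 < K \<Longrightarrow> uni_T a1 a2 K2 n m K * uni_denom K = a1 * (S K + b * K2)"
  using uni_denom_pos[of K] by (simp add: uni_T_eq)

lemma uni_T_pos: "0 < K \<Longrightarrow> 0 < uni_T a1 a2 K2 n m K"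
  using uni_denom_pos[of K] a1 b_pos K2 by (simp add: uni_T_eq S_def add_pos_pos)

lemma uni_theta_eq:
  assumes "0 < K"
  shows "uni_theta a1 a2 K2 n m K = (b * (1 + K2) - p * S K) / (S K + b * K2)"
proof -
  have pos: "0 < S K + b * K2" using assms K2 b_pos by (simp add: S_def add_pos_pos)
  have "uni_theta a1 a2 K2 n m K = b * uni_denom K / (S K + b * K2) - of_int m"
    using a1 by (simp add: uni_theta_def uni_T_eq gap_eq)
  also have "\<dots> = (b * uni_denom K - of_int m * (S K + b * K2)) / (S K + b * K2)"
    using pos by (simp add: field_simps)
  also have "b * uni_denom K - of_int m * (S K + b * K2) = b * (1 + K2) - p * S K"
    by (simp add: uni_denom_def m_eq algebra_simps)
  finally show ?thesis .
qed

text \<open>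
  The lower bound on the unimodal \<open>\<theta>\<close> is equivalent to \<open>G < 0\<close>, with equality at a root.
\<close>

lemma uni_theta_G:
  assumes "0 < K"
  shows "(S K - 2) * uni_theta a1 a2 K2 n m K - K2 = - G K / (S K + b * K2)"
proof -
  have pos: "0 < S K + b * K2" using assms K2 b_pos by (simp add: S_def add_pos_pos)
  then have "uni_theta a1 a2 K2 n m K * (S K + b * K2) = b * (1 + K2) - p * S K"
    by (simp add: uni_theta_eq[OF assms])
  then have "((S K - 2) * uni_theta a1 a2 K2 n m K - K2) * (S K + b * K2)
      = (S K - 2) * (b * (1 + K2) - p * S K) - K2 * (S K + b * K2)"
    by (simp only: left_diff_distrib mult.assoc)
  also have "\<dots> = - G K" by (simp add: G_eq_S S_def algebra_simps)
  finally show ?thesis using pos by (metis less_irrefl nonzero_eq_divide_eq)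
qed

lemma uni_balance:
  assumes "0 < K"
  defines "T \<equiv> uni_T a1 a2 K2 n m K" and "\<theta> \<equiv> uni_theta a1 a2 K2 n m K"
  shows "a2 - a1 = (of_int m + \<theta>) * T"
    and "a1 * (1 + K + K2) = of_nat n * T * (1 + K + K2) + T + K2 * (1 - \<theta>) * T"
proof -
  have T: "0 < T" unfolding T_def using assms(1) by (rule uni_T_pos)
  then show gap: "a2 - a1 = (of_int m + \<theta>) * T"
    by (simp add: \<theta>_def uni_theta_def T_def)
  have "T * uni_denom K = a1 * S K + (a2 - a1) * K2"
    using uni_T_uni_denom[OF assms(1)] by (simp add: T_def gap_eq algebra_simps)
  then show "a1 * (1 + K + K2) = of_nat n * T * (1 + K + K2) + T + K2 * (1 - \<theta>) * T"
    unfolding gap by (simp add: uni_denom_def S_def algebra_simps)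
qed

text \<open>
  The first two equations are the balance equations of the two slopes.  The third compares with the
  unimodal period, for which the same equation holds without the term \<open>T2\<close>: the periods agree
  exactly when \<open>T2 = 0\<close>.
\<close>

lemma bi_balance:
  assumes "bi_denom K2 n m K \<noteq> 0"
  defines "T \<equiv> bi_T a1 a2 K2 n m K" and "T2 \<equiv> bi_T2 a1 a2 K2 n m K"
  defines "q \<equiv> a2 - a1 - of_int m * T - T2"
  shows "a1 * S K = of_nat n * T * S K + (T - T2) + K2 * (T - T2 - q)"
    and "a1 * S K = of_nat n * T * S K + (T - T2 - q) + K * (q + T2)"
    and "T * uni_denom K = a1 * S K + (a2 - a1) * K2 + T2"
proof -
  define D where "D = bi_denom K2 n m K"
  have D: "D \<noteq> 0" using assms(1) by (simp add: D_def)
  have TD: "T * D = a1 * S K + (a2 - a1) * (1 - K)"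
    using D by (simp add: T_def bi_T_def D_def S_def)
  have T2D: "T2 * D = a1 * G K"
    using D by (simp add: T2_def bi_T2_def D_def G_def)
  have "T2 * D = (T * (K2 + of_int m * (S K - 2)) - (S K - 2) * (a2 - a1)) * D"
  proof -
    have "(T * (K2 + of_int m * (S K - 2)) - (S K - 2) * (a2 - a1)) * D
        = (T * D) * (K2 + of_int m * (S K - 2)) - (S K - 2) * (a2 - a1) * D"
      by (simp add: algebra_simps)
    also have "\<dots> = a1 * G K"
      unfolding TD unfolding gap_eq D_def bi_denom_def G_eq_S m_eq by (simp add: S_def algebra_simps)
    finally show ?thesis by (simp add: T2D)
  qed
  with D have T2: "T2 = T * (K2 + of_int m * (S K - 2)) - (S K - 2) * (a2 - a1)" by simp
  have TD': "T * (1 - of_int m * (K - 1) + of_nat n * S K) = a1 * S K + (a2 - a1) * (1 - K)"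
    using TD by (simp add: D_def bi_denom_def S_def)
  show 2: "a1 * S K = of_nat n * T * S K + (T - T2 - q) + K * (q + T2)"
    using TD' by (simp add: q_def algebra_simps)
  have "T2 = T * (K2 + of_int m * (K + K2 - 1)) - (K + K2 - 1) * (a2 - a1)"
    using T2 by (simp add: S_def)
  then have "K2 * (T - T2 - q) + q = K * (q + T2)" 
    by (simp add: q_def algebra_simps)
  with 2 show "a1 * S K = of_nat n * T * S K + (T - T2) + K2 * (T - T2 - q)" by simp
  show "T * uni_denom K = a1 * S K + (a2 - a1) * K2 + T2"
    using TD' T2 by (simp add: uni_denom_def S_def algebra_simps)
qed

definition "T0 = uni_T a1 a2 K2 n m M"
definition "\<theta>0 = K2 / (M + K2 - 1)"

lemma T0_pos: "0 < T0" unfolding T0_def using M_gt_1 by (intro uni_T_pos) simp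

lemma at_M: "bi_T2 a1 a2 K2 n m M = 0" "bi_T a1 a2 K2 n m M = T0" "bi_T1 a1 a2 K2 n m M = T0"
  "uni_theta a1 a2 K2 n m M = \<theta>0" "bi_theta a1 a2 K2 n m M = \<theta>0"
proof -
  show T2: "bi_T2 a1 a2 K2 n m M = 0" using G_M by (simp add: bi_T2_def G_def)
  have "bi_T a1 a2 K2 n m M * uni_denom M = a1 * S M + (a2 - a1) * K2"
    using bi_balance(3)[of M] bi_denom_neg[OF M_gt] by (simp add: T2)
  also have "\<dots> = T0 * uni_denom M"
    using uni_T_uni_denom[of M] M_gt_1 by (simp add: T0_def gap_eq algebra_simps)
  finally show T: "bi_T a1 a2 K2 n m M = T0" using uni_denom_pos[of M] M_gt_1 by simp
  show T1: "bi_T1 a1 a2 K2 n m M = T0" by (simp add: bi_T1_def T T2)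
  show \<theta>: "uni_theta a1 a2 K2 n m M = \<theta>0"
    using uni_theta_G[of M] M_gt_1 K2 by (simp add: G_M S_def \<theta>0_def field_simps)
  have "bi_theta a1 a2 K2 n m M = uni_theta a1 a2 K2 n m M"
    using T0_pos by (simp add: bi_theta_def T T1 T2 uni_theta_def T0_def[symmetric] diff_divide_distrib)
  with \<theta> show "bi_theta a1 a2 K2 n m M = \<theta>0" by simp
qed

lemma \<theta>0: "0 < \<theta>0" "\<theta>0 < 1 - 1 / M" "\<theta>0 < 1"
proof -
  show "0 < \<theta>0" using K2 M_gt_1 by (simp add: \<theta>0_def)
  have "K2 * M < (M - 1) * (M + K2 - 1)"
    using M_separation by (simp add: power2_eq_square algebra_simps)
  then show 1: "\<theta>0 < 1 - 1 / M" using K2 M_gt_1 by (simp add: \<theta>0_def field_simps)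
  show "\<theta>0 < 1" using 1 M_gt_1 by (smt (verit) zero_less_divide_1_iff)
qed

text \<open>
  All denominators are nonzero at \<open>M\<close>, so every quantity is continuous there.
\<close>

lemma limits:
  "((\<lambda>K. uni_T a1 a2 K2 n m K) \<longlongrightarrow> T0) (at_left M)"
  "((\<lambda>K. bi_T a1 a2 K2 n m K) \<longlongrightarrow> T0) (at_left M)"
  "((\<lambda>K. bi_T1 a1 a2 K2 n m K) \<longlongrightarrow> T0) (at_left M)"
  "((\<lambda>K. bi_T2 a1 a2 K2 n m K) \<longlongrightarrow> 0) (at_left M)"
  "((\<lambda>K. bi_theta a1 a2 K2 n m K) \<longlongrightarrow> \<theta>0) (at_left M)"
  "((\<lambda>K. uni_theta a1 a2 K2 n m K) \<longlongrightarrow> \<theta>0) (at_left M)"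
proof -
  have uni_denom: "1 + (of_int m + 1) * K2 + of_nat n * (1 + M + K2) \<noteq> 0"
    using uni_denom_pos[of M] M_gt_1 by (simp add: uni_denom_def S_def)
  have bd: "bi_denom K2 n m M \<noteq> 0" using bi_denom_neg[OF M_gt] by simp
  have bdc: "((\<lambda>K. bi_denom K2 n m K) \<longlongrightarrow> bi_denom K2 n m M) (at_left M)"
    unfolding bi_denom_def by (intro tendsto_intros)
  have u: "((\<lambda>K. uni_T a1 a2 K2 n m K) \<longlongrightarrow> uni_T a1 a2 K2 n m M) (at_left M)"
    unfolding uni_T_def by (intro tendsto_intros uni_denom)
  then show "((\<lambda>K. uni_T a1 a2 K2 n m K) \<longlongrightarrow> T0) (at_left M)" by (simp add: T0_def)
  have bT: "((\<lambda>K. bi_T a1 a2 K2 n m K) \<longlongrightarrow> bi_T a1 a2 K2 n m M) (at_left M)"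
    unfolding bi_T_def by (intro tendsto_intros bd bdc)
  then show "((\<lambda>K. bi_T a1 a2 K2 n m K) \<longlongrightarrow> T0) (at_left M)" by (simp add: at_M)
  have bT2: "((\<lambda>K. bi_T2 a1 a2 K2 n m K) \<longlongrightarrow> bi_T2 a1 a2 K2 n m M) (at_left M)"
    unfolding bi_T2_def G_poly_def by (intro tendsto_intros bd bdc)
  then show "((\<lambda>K. bi_T2 a1 a2 K2 n m K) \<longlongrightarrow> 0) (at_left M)" by (simp add: at_M)
  have bT1: "((\<lambda>K. bi_T1 a1 a2 K2 n m K) \<longlongrightarrow> bi_T1 a1 a2 K2 n m M) (at_left M)"
    unfolding bi_T1_def by (intro tendsto_intros bT bT2)
  then show "((\<lambda>K. bi_T1 a1 a2 K2 n m K) \<longlongrightarrow> T0) (at_left M)" by (simp add: at_M)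
  have "((\<lambda>K. bi_theta a1 a2 K2 n m K) \<longlongrightarrow> bi_theta a1 a2 K2 n m M) (at_left M)"
    unfolding bi_theta_def using T0_pos by (intro tendsto_intros bT bT2 bT1) (simp add: at_M)
  then show "((\<lambda>K. bi_theta a1 a2 K2 n m K) \<longlongrightarrow> \<theta>0) (at_left M)" by (simp add: at_M)
  have "((\<lambda>K. uni_theta a1 a2 K2 n m K) \<longlongrightarrow> uni_theta a1 a2 K2 n m M) (at_left M)"
    unfolding uni_theta_def using T0_pos by (intro tendsto_intros u) (simp add: T0_def)
  then show "((\<lambda>K. uni_theta a1 a2 K2 n m K) \<longlongrightarrow> \<theta>0) (at_left M)" by (simp add: at_M)
qed

lemma eventually_G_neg: "\<forall>\<^sub>F K in at_left M. 1 + 1 / p < K \<and> 1 < K \<and> G K < 0"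
proof -
  have "\<forall>\<^sub>F K in at_left M. 1 + 1 / p < K \<and> K < M"
    unfolding eventually_at_left[OF M_gt] using M_gt by blast
  then show ?thesis
  proof eventually_elim
    case (elim K)
    moreover have "0 < 1 / p" using p_pos by simp
    ultimately have "1 < K" by linarith
    with elim show ?case using G_neg[of K] by simp
  qed
qed

lemma eventually_unimodal: "\<forall>\<^sub>F K in at_left M. unimodal_solution a1 a2 c K2 n m K"
  using eventually_G_neg order_tendstoD(2)[OF limits(6) \<theta>0(3)]
proof eventually_elim
  case (elim K)
  define \<theta> where "\<theta> = uni_theta a1 a2 K2 n m K"
  have K: "0 < K" "1 < K" using elim by simp_all
  have "0 < - G K / (S K + b * K2)"
    using elim K K2 b_pos by (intro divide_pos_pos) (simp_all add: S_def add_pos_pos)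
  with uni_theta_G[OF K(1)] have \<theta>: "K2 < (K + K2 - 1) * \<theta>" by (simp add: S_def \<theta>_def)
  then have "K2 / (K + K2 - 1) < \<theta>" using K K2 by (simp add: field_simps)
  moreover from this have "0 < \<theta>" using K K2 by (smt (verit) divide_pos_pos)
  ultimately show ?case
    using unimodal_periodic_solution[OF c uni_T_pos[OF K(1)], of \<theta> K a2 a1 m K2 n]
      uni_balance[OF K(1)] elim K K2 \<theta>
    by (simp add: unimodal_solution_def \<theta>_def)
qed

text \<open>
  Apart from \<open>T2 > 0\<close>, each required inequality is strict in the limit, where \<open>T2 = 0\<close> and
  \<open>0 < \<theta>0 < 1 - 1 / M\<close>.
\<close>

lemma eventually_bimodal: "\<forall>\<^sub>F K in at_left M. bimodal_I_solution a1 a2 c K2 n m K"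
proof -
  define T T1 T2 \<theta> where "T = bi_T a1 a2 K2 n m" and "T1 = bi_T1 a1 a2 K2 n m"
    and "T2 = bi_T2 a1 a2 K2 n m" and "\<theta> = bi_theta a1 a2 K2 n m"
  have lim: "(T1 \<longlongrightarrow> T0) (at_left M)" "(T2 \<longlongrightarrow> 0) (at_left M)" "(\<theta> \<longlongrightarrow> \<theta>0) (at_left M)"
    "(T \<longlongrightarrow> T0) (at_left M)"
    using limits unfolding T_def T1_def T2_def \<theta>_def by simp_all
  have M0: "M \<noteq> 0" "M - 1 \<noteq> 0" using M_gt_1 by simp_all
  have "((\<lambda>K. 1 - 1 / K - \<theta> K) \<longlongrightarrow> 1 - 1 / M - \<theta>0) (at_left M)"
    by (intro tendsto_intros lim M0)
  then have e1: "\<forall>\<^sub>F K in at_left M. 0 < 1 - 1 / K - \<theta> K"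
    by (rule order_tendstoD(1)) (use \<theta>0(2) in linarith)
  have "((\<lambda>K. \<theta> K * T1 K - K2 / (K - 1) * T2 K) \<longlongrightarrow> \<theta>0 * T0 - K2 / (M - 1) * 0) (at_left M)"
    by (intro tendsto_intros lim M0)
  then have e2: "\<forall>\<^sub>F K in at_left M. 0 < \<theta> K * T1 K - K2 / (K - 1) * T2 K"
    by (rule order_tendstoD(1)) (use \<theta>0(1) T0_pos in simp)
  have "((\<lambda>K. T1 K - 1 / K2 * T2 K - \<theta> K * T1 K) \<longlongrightarrow> T0 - 1 / K2 * 0 - \<theta>0 * T0) (at_left M)"
    by (intro tendsto_intros lim)
  then have e3: "\<forall>\<^sub>F K in at_left M. 0 < T1 K - 1 / K2 * T2 K - \<theta> K * T1 K"
    by (rule order_tendstoD(1)) (use \<theta>0(3) T0_pos in simp)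
  have "((\<lambda>K. (K - 1) * T1 K - K * (\<theta> K * T1 K) - (K + K2 - 1) * T2 K) \<longlongrightarrow>
      (M - 1) * T0 - M * (\<theta>0 * T0) - (M + K2 - 1) * 0) (at_left M)"
    by (intro tendsto_intros lim)
  moreover have "0 < (M - 1) * T0 - M * (\<theta>0 * T0) - (M + K2 - 1) * 0"
  proof -
    have "M * \<theta>0 < M - 1" using \<theta>0(2) M_gt_1 by (simp add: field_simps)
    then have "(M * \<theta>0) * T0 < (M - 1) * T0" using T0_pos by (intro mult_strict_right_mono)
    then show ?thesis by simp
  qed
  ultimately have e4: "\<forall>\<^sub>F K in at_left M. 0 < (K - 1) * T1 K - K * (\<theta> K * T1 K) - (K + K2 - 1) * T2 K"
    by (rule order_tendstoD(1))
  show ?thesis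
    using eventually_G_neg order_tendstoD(1)[OF lim(1) T0_pos] order_tendstoD(1)[OF lim(4) T0_pos]
      order_tendstoD(1)[OF lim(3) \<theta>0(1)] e1 e2 e3 e4
  proof eventually_elim
    case (elim K)
    have K: "1 < K" "0 < K" using elim by simp_all
    have D: "bi_denom K2 n m K < 0" using elim by (intro bi_denom_neg) simp
    have T1: "T1 K = T K - T2 K" by (simp add: T1_def T_def T2_def bi_T1_def)
    have "a1 * G K < 0" using a1 elim by (simp add: mult_pos_neg)
    then have T2: "0 < T2 K" using D by (simp add: T2_def bi_T2_def G_def[symmetric] divide_neg_neg)
    define q where "q = \<theta> K * T1 K"
    have q: "q = a2 - a1 - of_int m * T K - T2 K"
      using elim by (simp add: q_def \<theta>_def bi_theta_def T_def T1_def T2_def)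
    have q_pos: "0 < q" using elim by (simp add: q_def)
    have room: "T2 K / K2 < T1 K - q" "K2 / (K - 1) * T2 K < q" using elim by (simp_all add: q_def)
    have "T2 K \<le> T2 K / K2" using T2 K2 by (simp add: field_simps)
    then have fit: "T2 K + q < T1 K" using room(1) by linarith
    have jump2: "K2 * T2 K < (K - 1) * q" using room(2) K by (simp add: field_simps)
    have "\<theta> K * T1 K < (1 - 1 / K) * T1 K" using elim by (intro mult_strict_right_mono) simp_all
    then have drop: "T1 K / K < T1 K - q" by (simp add: q_def algebra_simps)
    have bal: "a1 * (1 + K + K2) = of_nat n * (T1 K + T2 K) * (1 + K + K2) + T1 K + K2 * (T1 K - q)"
      "a1 * (1 + K + K2) = of_nat n * (T1 K + T2 K) * (1 + K + K2) + (T1 K - q) + K * (q + T2 K)"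
      using bi_balance(1,2)[OF less_imp_neq[OF D], folded T_def T2_def, folded q]
      by (simp_all only: T1 S_def diff_add_cancel)
    have gap: "a2 - a1 = of_int m * (T1 K + T2 K) + T2 K + q" by (simp add: q T1)
    have jump1: "K * q + (K + K2 - 1) * T2 K < (K - 1) * T1 K" using elim by (simp add: q_def)
    have "\<exists>\<mu>0 \<mu>1 \<mu>2. periodic_singular_solution a1 a2 c K K2
        (bi_curve a1 c n (T1 K) (T2 K) (\<theta> K)) UNIV \<mu>0 \<mu>1 \<mu>2 (T1 K + T2 K)"
      by (rule bimodal_periodic_solution[OF c T2 q_pos q_def K(1) K2 fit drop room(1) gap bal jump2 jump1])
    then show ?case
      using elim K D T2 T1
      by (simp add: bimodal_I_solution_def Let_def T_def[symmetric] T1_def[symmetric]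
          T2_def[symmetric] \<theta>_def[symmetric])
  qed
qed

end

section \<open>Coexistence and coincidence at the critical value\<close>

theorem theorem3p3:
  fixes a1 a2 c A K2 M :: real and n :: nat and m :: int
  assumes "0 < a1" and "a1 < a2" and "0 < c" and "A = a2 / a1"
    and "0 < K2" and "K2 < 1"
    and "of_nat n * (A - 1) < of_int m" and "of_int m < m_dagger A K2 n"
    and "M = M_plus A K2 n m"
  shows "\<exists>\<delta>>0.
    (\<forall>K1\<in>{M - \<delta><..<M}.
        unimodal_solution a1 a2 c K2 n m K1 \<and> bimodal_I_solution a1 a2 c K2 n m K1) \<and>
    (\<exists>T \<Gamma>u \<Gamma>b.
        ((\<lambda>K1. uni_T a1 a2 K2 n m K1) \<longlongrightarrow> T) (at_left M) \<and>
        ((\<lambda>K1. bi_T a1 a2 K2 n m K1) \<longlongrightarrow> T) (at_left M) \<and>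
        limiting_profile (\<lambda>K1. uni_curve a1 c n (uni_T a1 a2 K2 n m K1)) (at_left M) \<Gamma>u \<and>
        limiting_profile
          (\<lambda>K1. bi_curve a1 c n (bi_T1 a1 a2 K2 n m K1) (bi_T2 a1 a2 K2 n m K1)
                  (bi_theta a1 a2 K2 n m K1)) (at_left M) \<Gamma>b \<and>
        range \<Gamma>u = range \<Gamma>b)"
proof -
  interpret critical_regime a1 a2 c K2 M n m
    by unfold_locales (use assms in simp_all)
  have "\<forall>\<^sub>F K in at_left M. unimodal_solution a1 a2 c K2 n m K \<and> bimodal_I_solution a1 a2 c K2 n m K"
    using eventually_unimodal eventually_bimodal by (rule eventually_conj)
  then obtain L where "L < M" and L:
      "\<And>K. L < K \<Longrightarrow> K < M \<Longrightarrow> unimodal_solution a1 a2 c K2 n m K \<and> bimodal_I_solution a1 a2 c K2 n m K"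
    unfolding eventually_at_left[OF M_gt] by blast
  show ?thesis
  proof (rule exI[of _ "M - L"], intro conjI ballI, goal_cases)
    case 1
    show ?case using \<open>L < M\<close> by simp
  next
    case 4
    have "range (uni_curve a1 c n T0) = range (bi_curve a1 c n T0 0 \<theta>0)"
      using range_bi_curve_degenerate[of \<theta>0] \<theta>0 by simp
    with limits limiting_profile_uni_curve[OF limits(1)] limiting_profile_bi_curve[OF limits(3,4,5)]
    show ?case by blast
  qed (use L in simp_all)
qed

end
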